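(* Let $(X,\varrho)$ be a represented space, let $X^*$ be the Moschovakis extension of $X$ and let $\varrho^*$ be the associated representation of $X^*$. Let $\mathcal{F}_2$ be the set of all partial functions from $X^*$ to the set of the non-empty subsets of $X^*$, and let $\mathcal{B}_2$ be the set of all functions from $\mathcal{F}_2$ which are $(\varrho^*,\varrho^* )$-computable. Then all functions in $\mathcal{F}_2$ that are $\mathfrak{S}_2(X)$-computable in $\mathcal{B}_2$ belong to $\mathcal{B}_2$.
   Context: A representation of a set is a partial mapping of $\mathbb{N}^{\mathbb{N}}$ onto that set; a represented space is a pair (set, representation of that set). Moschovakis extension: fix an object $\boldsymbol{o}\notin X$ and an ordered pair operation such that no element of $X\cup\{\boldsymbol{o}\}$ is an ordered pair; $X^*$ is the closure of $X\cup\{\boldsymbol{o}\}$ under formation of ordered pairs. Representation $\varrho^*$: fix a computable bijection $J:\mathbb{N}^2\to\mathbb{N}$ with $J(m,n)\ge\max(m,n)$ for all $m,n$. The partial mapping $\varrho^*$ of $\mathbb{N}^{\mathbb{N}}$ onto $X^*$ is defined inductively (with $k$ ranging over $\mathbb{N}$): (i) for $q\in\mathrm{dom}(\varrho)$, the sequence $k\mapsto 2q(k)+2$ is in $\mathrm{dom}(\varrho^* )$ and is mapped to $\varrho(q)$; (ii) the constant sequence $k\mapsto 0$ is in $\mathrm{dom}(\varrho^* )$ and is mapped to $\boldsymbol{o}$; (iii) if $q,r\in\mathrm{dom}(\varrho^* )$ then the sequence $k\mapsto 2J(q(k),r(k))+1$ is in $\mathrm{dom}(\varrho^* )$ and is mapped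 to $(\varrho^*(q),\varrho^*(r))$. Computability of multi-valued functions: a partial mapping $\gamma$ of $\mathbb{N}^{\mathbb{N}}$ into $\mathbb{N}^{\mathbb{N}}$ is computable in the usual (type-2, oracle machine) sense: some oracle machine, given $p\in\mathrm{dom}(\gamma)$ as oracle and $k\in\mathbb{N}$ as input, outputs $\gamma(p)(k)$. For represented spaces $(X_1,\varrho_1)$, $(X_2,\varrho_2)$, a $(\varrho_1,\varrho_2)$-realization of a partial function $\varphi$ from $X_1$ to the set of the non-empty subsets of $X_2$ is any partial mapping $\gamma$ of $\mathbb{N}^{\mathbb{N}}$ into $\mathbb{N}^{\mathbb{N}}$ such that $p\in\mathrm{dom}(\gamma)$, $\gamma(p)\in\mathrm{dom}(\varrho_2)$ and $\varrho_2(\gamma(p))\in\varphi(\varrho_1(p))$ for all $p\in\varrho_1^{-1}(\mathrm{dom}(\varphi))$; $\varphi$ is $(\varrho_1,\varrho_2)$-computable if it has a computable $(\varrho_1,\varrho_2)$-realization. The structure $\mathfrak{S}_2(X)$ on $\mathcal{F}_2$: - Multiplication: $\mathrm{dom}(\varphi\psi)=\{x\in\mathrm{dom}(\psi)\mid\psi(x)\subseteq\mathrm{dom}(\varphi)\}$ and $\varphi\psi(x)=\bigcup\{\varphi(y)\mid y\in\psi(x)\}$ for $x\in\mathrm{dom}(\varphi\psi)$. - $L_2,R_2,T_2,F_2$ are total and single-valued: $L_2(z)=\{L_1(z)\}$, $R_2(z)=\{R_1(z)\}$, where $L_1(\boldsymbol{o})=R_1(\boldsymbol{o})=\boldsymbol{o}$,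 $L_1(z)=R_1(z)=(\boldsymbol{o},\boldsymbol{o})$ for $z\in X$, $L_1((x,y))=x$, $R_1((x,y))=y$; and $T_2(z)=\{(\boldsymbol{o},\boldsymbol{o})\}$, $F_2(z)=\{\boldsymbol{o}\}$ for all $z\in X^*$. - $\Pi_2(\varphi,\psi)(z)=\{(x,y)\mid x\in\varphi(z)\ \&\ y\in\psi(z)\}$ with domain $\mathrm{dom}(\varphi)\cap\mathrm{dom}(\psi)$. - Iteration $[\sigma,\chi]$ of $\sigma\in\mathcal{F}_2$ controlled by $\chi\in\mathcal{F}_2$: a $\sigma,\chi$-path is a finite or infinite sequence of elements of $X^*$ such that, whenever $u$ is a term of it and $u'$ is its next term, $u\in\mathrm{dom}(\chi)\cap\mathrm{dom}(\sigma)$, $\chi(u)\setminus(X\cup\{\boldsymbol{o}\})\ne\varnothing$ and $u'\in\sigma(u)$. Then $\mathrm{dom}([\sigma,\chi])$ consists of the $z\in X^*$ such that (i) all $\sigma,\chi$-paths beginning at $z$ are finite, and (ii) whenever $u$ is a term of some $\sigma,\chi$-path beginning at $z$, then $u\in\mathrm{dom}(\chi)$ and ($\chi(u)\setminus(X\cup\{\boldsymbol{o}\})\ne\varnothing$ implies $u\in\mathrm{dom}(\sigma)$). For $z\in\mathrm{dom}([\sigma,\chi])$, the set $[\sigma,\chi](z)$ consists of the $v$ such that $z$ and $v$ are the initial and last terms of some finite $\sigma,\chi$-path and $v\in\mathrm{dom}(\chi)$, $\chi(v)\cap(X\cup\{\boldsymbol{o}\})\ne\varnothing$. An element $\theta\in\mathcal{F}_2$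 is $\mathfrak{S}_2(X)$-computable in a subset $\mathcal{B}\subseteq\mathcal{F}_2$ if $\theta$ can be obtained from $L_2,R_2,T_2,F_2$ and finitely many elements of $\mathcal{B}$ by means of multiplication, $\Pi_2$ and iteration. *)

theory Defs
  imports Main
begin

(* Oracle machines: unlimited register machines with one oracle instruction.  Registers hold
   natural numbers; a computation halts when the program counter leaves the program. *)

type_synonym baire = "nat \<Rightarrow> nat"

datatype instr =
    Clear nat             (* R_i := 0 *)
  | Incr nat              (* R_i := R_i + 1 *)
  | Copy nat nat          (* R_j := R_i *)
  | JumpEq nat nat nat    (* if R_i = R_j then go to instruction t *)
  | Query nat             (* R_i := oracle (R_i) *)

type_synonym config = "nat \<times> (nat \<Rightarrow> nat)"

fun exec_instr :: "baire \<Rightarrow> instr \<Rightarrow> config \<Rightarrow> config" where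
  "exec_instr p (Clear i) (pc, R) = (Suc pc, R(i := 0))"
| "exec_instr p (Incr i) (pc, R) = (Suc pc, R(i := Suc (R i)))"
| "exec_instr p (Copy i j) (pc, R) = (Suc pc, R(j := R i))"
| "exec_instr p (JumpEq i j t) (pc, R) = (if R i = R j then t else Suc pc, R)"
| "exec_instr p (Query i) (pc, R) = (Suc pc, R(i := p (R i)))"

definition machine_step :: "instr list \<Rightarrow> baire \<Rightarrow> config \<Rightarrow> config" where
  "machine_step P p c = (if fst c < length P then exec_instr p (P ! fst c) c else c)"

definition initial_regs :: "nat list \<Rightarrow> nat \<Rightarrow> nat" where
  "initial_regs ks i = (if i < length ks then ks ! i else 0)"

definition machine_outputs :: "instr list \<Rightarrow> baire \<Rightarrow> nat list \<Rightarrow> nat \<Rightarrow> bool" where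
  "machine_outputs P p ks v \<longleftrightarrow>
     (\<exists>n pc R. (machine_step P p ^^ n) (0, initial_regs ks) = (pc, R)
        \<and> length P \<le> pc \<and> R 0 = v)"

(* Ordinary computability of a total binary function: without an oracle instruction in the
   program, the choice of the oracle does not matter. *)
definition computable_nat2 :: "(nat \<times> nat \<Rightarrow> nat) \<Rightarrow> bool" where
  "computable_nat2 f \<longleftrightarrow>
     (\<exists>P. (\<forall>i. Query i \<notin> set P) \<and> (\<forall>p m n. machine_outputs P p [m, n] (f (m, n))))"

(* Nothing is required of the machine on oracles outside the domain. *)
definition computable_baire :: "(baire \<rightharpoonup> baire) \<Rightarrow> bool" where
  "computable_baire \<gamma> \<longleftrightarrow>
     (\<exists>P. \<forall>p q. \<gamma> p = Some q \<longrightarrow> (\<forall>k. machine_outputs P p [k] (q k)))"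

(* A partial function from A to the non-empty subsets of B is a map into set option, where None
   means undefined. *)

type_synonym ('a, 'b) multifun = "'a \<rightharpoonup> 'b set"

definition representation :: "(baire \<rightharpoonup> 'a) \<Rightarrow> 'a set \<Rightarrow> bool" where
  "representation \<rho> A \<longleftrightarrow> ran \<rho> = A"

definition realization ::
    "(baire \<rightharpoonup> 'a) \<Rightarrow> (baire \<rightharpoonup> 'b) \<Rightarrow> (baire \<rightharpoonup> baire) \<Rightarrow> ('a, 'b) multifun \<Rightarrow> bool" where
  "realization \<rho>1 \<rho>2 \<gamma> \<phi> \<longleftrightarrow>
     (\<forall>p x Y. \<rho>1 p = Some x \<and> \<phi> x = Some Y \<longrightarrow>
        (\<exists>q y. \<gamma> p = Some q \<and> \<rho>2 q = Some y \<and> y \<in> Y))"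

definition computable_multifun ::
    "(baire \<rightharpoonup> 'a) \<Rightarrow> (baire \<rightharpoonup> 'b) \<Rightarrow> ('a, 'b) multifun \<Rightarrow> bool" where
  "computable_multifun \<rho>1 \<rho>2 \<phi> \<longleftrightarrow> (\<exists>\<gamma>. computable_baire \<gamma> \<and> realization \<rho>1 \<rho>2 \<gamma> \<phi>)"

(* The object o and the ordered pair operation are free constructors, so that o is not in X and
   neither o nor an element of X is a pair; an element x of X is embedded as Atom x. *)
datatype 'a mosch = Atom 'a | Obj | Pair "'a mosch" "'a mosch"

definition basic :: "'a set \<Rightarrow> 'a mosch set" where
  "basic X = Atom ` X \<union> {Obj}"

inductive_set mosch_ext :: "'a set \<Rightarrow> 'a mosch set" for X :: "'a set" where
  basic: "z \<in> basic X \<Longrightarrow> z \<in> mosch_ext X"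
| pair: "x \<in> mosch_ext X \<Longrightarrow> y \<in> mosch_ext X \<Longrightarrow> Pair x y \<in> mosch_ext X"

(* The graph of the representation of the extension; it is single-valued for injective J. *)
inductive star_name :: "(nat \<times> nat \<Rightarrow> nat) \<Rightarrow> (baire \<rightharpoonup> 'a) \<Rightarrow> baire \<Rightarrow> 'a mosch \<Rightarrow> bool"
  for J :: "nat \<times> nat \<Rightarrow> nat" and \<rho> :: "baire \<rightharpoonup> 'a" where
  atom: "\<rho> q = Some x \<Longrightarrow> star_name J \<rho> (\<lambda>k. 2 * q k + 2) (Atom x)"
| obj: "star_name J \<rho> (\<lambda>k. 0) Obj"
| pair: "star_name J \<rho> q y \<Longrightarrow> star_name J \<rho> r z \<Longrightarrow>
    star_name J \<rho> (\<lambda>k. 2 * J (q k, r k) + 1) (Pair y z)"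

definition star_rep :: "(nat \<times> nat \<Rightarrow> nat) \<Rightarrow> (baire \<rightharpoonup> 'a) \<Rightarrow> (baire \<rightharpoonup> 'a mosch)" where
  "star_rep J \<rho> q = (if \<exists>z. star_name J \<rho> q z then Some (THE z. star_name J \<rho> q z) else None)"

lemma star_name_unique:
  assumes "inj J" "star_name J \<rho> q z" "star_name J \<rho> q z'"
  shows "z = z'"
  using assms(2,3)
proof (induction arbitrary: z' rule: star_name.induct)
  case (atom q x)
  from atom.prems show ?case
  proof cases
    case (atom q' x')
    have "q = q'"
    proof
      fix k show "q k = q' k" using fun_cong[OF atom(1), of k] by simp
    qed
    then show ?thesis using atom \<open>\<rho> q = Some x\<close> by simp
  next
    case obj
    then show ?thesis using fun_cong[OF obj(1), of 0] by simp
  next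
    case (pair q' y r z)
    then show ?thesis using fun_cong[OF pair(1), of 0] by presburger
  qed
next
  case obj
  from obj.prems show ?case
  proof cases
    case (atom q' x')
    then show ?thesis using fun_cong[OF atom(1), of 0] by simp
  next
    case (pair q' y r z)
    then show ?thesis using fun_cong[OF pair(1), of 0] by simp
  qed simp
next
  case (pair q y r z)
  from pair.prems show ?case
  proof cases
    case (atom q' x')
    then show ?thesis using fun_cong[OF atom(1), of 0] by presburger
  next
    case obj
    then show ?thesis using fun_cong[OF obj(1), of 0] by simp
  next
    case (pair q' y' r' z')
    have *: "(q k, r k) = (q' k, r' k)" for k
      using fun_cong[OF pair(1), of k] \<open>inj J\<close> by (auto dest!: injD)
    then have "q = q'" "r = r'" by auto
    then show ?thesis using pair pair.IH \<open>\<And>z'. star_name J \<rho> q z' \<Longrightarrow> y = z'\<close>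
        \<open>\<And>z'. star_name J \<rho> r z' \<Longrightarrow> z = z'\<close> by auto
  qed
qed

lemma star_rep_iff:
  assumes "inj J"
  shows "star_rep J \<rho> q = Some z \<longleftrightarrow> star_name J \<rho> q z"
proof -
  have "(THE z. star_name J \<rho> q z) = z" if "star_name J \<rho> q z" for z
    using that star_name_unique[OF assms] by (blast intro: the_equality)
  then show ?thesis unfolding star_rep_def by auto
qed

lemma representation_star_rep:
  assumes "inj J" "representation \<rho> X"
  shows "representation (star_rep J \<rho>) (mosch_ext X)"
proof -
  have ran: "ran \<rho> = X" using assms(2) by (simp add: representation_def)
  have 1: "z \<in> mosch_ext X" if "star_name J \<rho> q z" for q z
    using that
  proof induction
    case (atom q x)
    then have "Atom x \<in> basic X" using ran by (auto simp: basic_def intro: ranI)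
    then show ?case by (rule mosch_ext.basic)
  qed (auto simp: basic_def intro: mosch_ext.intros)
  have 2: "\<exists>q. star_name J \<rho> q z" if "z \<in> mosch_ext X" for z
    using that
  proof induction
    case (basic z)
    then show ?case using ran
      by (fastforce simp: basic_def ran_def intro: star_name.intros)
  qed (blast intro: star_name.intros)
  show ?thesis
    unfolding representation_def ran_def star_rep_iff[OF assms(1)] using 1 2 by blast
qed

definition calF2 :: "'a set \<Rightarrow> ('a mosch, 'a mosch) multifun set" where
  "calF2 X = {\<phi>. dom \<phi> \<subseteq> mosch_ext X \<and> (\<forall>Y \<in> ran \<phi>. Y \<noteq> {} \<and> Y \<subseteq> mosch_ext X)}"

definition mult :: "('b, 'c) multifun \<Rightarrow> ('a, 'b) multifun \<Rightarrow> ('a, 'c) multifun" where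
  "mult \<phi> \<psi> x = (case \<psi> x of None \<Rightarrow> None
     | Some Y \<Rightarrow> if Y \<subseteq> dom \<phi> then Some (\<Union>y\<in>Y. the (\<phi> y)) else None)"

fun L1 :: "'a mosch \<Rightarrow> 'a mosch" where
  "L1 Obj = Obj"
| "L1 (Atom x) = Pair Obj Obj"
| "L1 (Pair x y) = x"

fun R1 :: "'a mosch \<Rightarrow> 'a mosch" where
  "R1 Obj = Obj"
| "R1 (Atom x) = Pair Obj Obj"
| "R1 (Pair x y) = y"

definition L2 :: "'a set \<Rightarrow> ('a mosch, 'a mosch) multifun" where
  "L2 X = (\<lambda>z. if z \<in> mosch_ext X then Some {L1 z} else None)"

definition R2 :: "'a set \<Rightarrow> ('a mosch, 'a mosch) multifun" where
  "R2 X = (\<lambda>z. if z \<in> mosch_ext X then Some {R1 z} else None)"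

definition T2 :: "'a set \<Rightarrow> ('a mosch, 'a mosch) multifun" where
  "T2 X = (\<lambda>z. if z \<in> mosch_ext X then Some {Pair Obj Obj} else None)"

definition F2 :: "'a set \<Rightarrow> ('a mosch, 'a mosch) multifun" where
  "F2 X = (\<lambda>z. if z \<in> mosch_ext X then Some {Obj} else None)"

definition Pi2 ::
    "('b, 'a mosch) multifun \<Rightarrow> ('b, 'a mosch) multifun \<Rightarrow> ('b, 'a mosch) multifun" where
  "Pi2 \<phi> \<psi> z = (case (\<phi> z, \<psi> z) of
       (Some Y, Some Z) \<Rightarrow> Some {Pair x y |x y. x \<in> Y \<and> y \<in> Z}
     | _ \<Rightarrow> None)"

definition path_step ::
    "'a set \<Rightarrow> ('a mosch, 'a mosch) multifun \<Rightarrow> ('a mosch, 'a mosch) multifun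
      \<Rightarrow> 'a mosch \<Rightarrow> 'a mosch \<Rightarrow> bool" where
  "path_step X \<sigma> \<chi> u u' \<longleftrightarrow>
     u \<in> dom \<chi> \<inter> dom \<sigma> \<and> the (\<chi> u) - basic X \<noteq> {} \<and> u' \<in> the (\<sigma> u)"

definition finite_path ::
    "'a set \<Rightarrow> ('a mosch, 'a mosch) multifun \<Rightarrow> ('a mosch, 'a mosch) multifun
      \<Rightarrow> 'a mosch list \<Rightarrow> bool" where
  "finite_path X \<sigma> \<chi> us \<longleftrightarrow>
     us \<noteq> [] \<and> set us \<subseteq> mosch_ext X \<and> successively (path_step X \<sigma> \<chi>) us"

definition infinite_path ::
    "'a set \<Rightarrow> ('a mosch, 'a mosch) multifun \<Rightarrow> ('a mosch, 'a mosch) multifun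
      \<Rightarrow> (nat \<Rightarrow> 'a mosch) \<Rightarrow> bool" where
  "infinite_path X \<sigma> \<chi> f \<longleftrightarrow>
     range f \<subseteq> mosch_ext X \<and> (\<forall>n. path_step X \<sigma> \<chi> (f n) (f (Suc n)))"

definition term_of_path_from ::
    "'a set \<Rightarrow> ('a mosch, 'a mosch) multifun \<Rightarrow> ('a mosch, 'a mosch) multifun
      \<Rightarrow> 'a mosch \<Rightarrow> 'a mosch \<Rightarrow> bool" where
  "term_of_path_from X \<sigma> \<chi> z u \<longleftrightarrow>
     (\<exists>us. finite_path X \<sigma> \<chi> us \<and> hd us = z \<and> u \<in> set us)
   \<or> (\<exists>f. infinite_path X \<sigma> \<chi> f \<and> f 0 = z \<and> u \<in> range f)"

definition iteration_dom ::
    "'a set \<Rightarrow> ('a mosch, 'a mosch) multifun \<Rightarrow> ('a mosch, 'a mosch) multifun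
      \<Rightarrow> 'a mosch set" where
  "iteration_dom X \<sigma> \<chi> = {z \<in> mosch_ext X.
     \<not> (\<exists>f. infinite_path X \<sigma> \<chi> f \<and> f 0 = z)
   \<and> (\<forall>u. term_of_path_from X \<sigma> \<chi> z u \<longrightarrow>
        u \<in> dom \<chi> \<and> (the (\<chi> u) - basic X \<noteq> {} \<longrightarrow> u \<in> dom \<sigma>))}"

definition iteration ::
    "'a set \<Rightarrow> ('a mosch, 'a mosch) multifun \<Rightarrow> ('a mosch, 'a mosch) multifun
      \<Rightarrow> ('a mosch, 'a mosch) multifun" where
  "iteration X \<sigma> \<chi> z = (if z \<in> iteration_dom X \<sigma> \<chi>
     then Some {v. (\<exists>us. finite_path X \<sigma> \<chi> us \<and> hd us = z \<and> last us = v)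
                 \<and> v \<in> dom \<chi> \<and> the (\<chi> v) \<inter> basic X \<noteq> {}}
     else None)"

inductive S2_computable ::
    "'a set \<Rightarrow> ('a mosch, 'a mosch) multifun set \<Rightarrow> ('a mosch, 'a mosch) multifun \<Rightarrow> bool"
  for X :: "'a set" and B :: "('a mosch, 'a mosch) multifun set" where
  L: "S2_computable X B (L2 X)"
| R: "S2_computable X B (R2 X)"
| T: "S2_computable X B (T2 X)"
| F: "S2_computable X B (F2 X)"
| given: "\<theta> \<in> B \<Longrightarrow> S2_computable X B \<theta>"
| mult: "S2_computable X B \<phi> \<Longrightarrow> S2_computable X B \<psi> \<Longrightarrow> S2_computable X B (mult \<phi> \<psi>)"
| Pi: "S2_computable X B \<phi> \<Longrightarrow> S2_computable X B \<psi> \<Longrightarrow> S2_computable X B (Pi2 \<phi> \<psi>)"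
| iter: "S2_computable X B \<sigma> \<Longrightarrow> S2_computable X B \<chi> \<Longrightarrow> S2_computable X B (iteration X \<sigma> \<chi>)"

definition calB2 ::
    "'a set \<Rightarrow> (nat \<times> nat \<Rightarrow> nat) \<Rightarrow> (baire \<rightharpoonup> 'a) \<Rightarrow> ('a mosch, 'a mosch) multifun set" where
  "calB2 X J \<rho> = {\<phi> \<in> calF2 X. computable_multifun (star_rep J \<rho>) (star_rep J \<rho>) \<phi>}"

end

theory Submission
  imports Defs "HOL-Library.Nat_Bijection"
begin

text \<open>
  The functions with a computable realization contain the four basic ones and are closed under
  multiplication, pairing and iteration; the theorem follows by induction on the construction of a
  function. Each closure property has a set-theoretic half, which says which name of which value a
  realizer has to produce, and a machine half, which produces it.

  The set-theoretic half is short. The first entry of a name decides whether the named object is a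
  pair: exactly the pairs have names with an odd first entry. A realizer of an iteration therefore
  applies a realizer \<open>\<gamma>\<close> of \<open>\<sigma>\<close> repeatedly to the given name, and before each application runs a
  realizer \<open>\<delta>\<close> of \<open>\<chi>\<close> on the current name. An odd first entry of the result shows that the value
  set of \<open>\<chi>\<close> contains a pair, so that the path may be continued; an even one shows that this set
  meets the basic objects, so that the current name may be returned. Which of the two happens can
  depend on the name, not just on the object, but either choice is permitted by the definition of
  the iteration. The names visited this way name the terms of a path, and since no infinite path
  starts in the domain of the iteration, the process ends.

  The machine half is harder, because an oracle machine gives its answers entry by entry: entry
  \<open>k\<close> of the name \<open>q\<^sub>n\<close> reached after \<open>n\<close> applications of \<open>\<gamma>\<close> is computed by running the machine
  of \<open>\<gamma>\<close> with oracle \<open>q\<^bsub>n-1\<^esub>\<close>, whose entries are themselves only available through such runs, down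
  to the true oracle \<open>q\<^sub>0\<close>. The depth \<open>n\<close> of this nesting is not known in advance, while a register
  machine has a fixed finite set of registers without indirect addressing. So the interrupted runs
  are kept on a stack that is coded as one number. The coding uses the pairing function \<open>2J + 1\<close> of
  the names; it is inverted by search, which \<open>J(m,n) \<ge> max(m,n)\<close> bounds. The same two programs, for
  pairing and its inverse, serve for the realizers of \<open>\<Pi>\<^sub>2\<close>, \<open>L\<^sub>2\<close> and \<open>R\<^sub>2\<close>.

  Programs are written in a small structured language with a predicate transformer semantics, and
  translated to register machines once and for all (\<open>computable_baireI\<close>). The facts that carry the
  proof are \<open>wp_Call\<close> (running a machine whose queries are answered by a subprogram),
  \<open>wp_nested_run\<close> (correctness of the stack evaluation), \<open>computable_iterate\<close> (the iteration process
  is computable) and \<open>iteration_mem\<close> (the process realizes the iteration).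
\<close>

section \<open>A register language\<close>

text \<open>
  A variable consists of a block and an index. Subprograms that must not disturb each other use
  different blocks: 0 holds input and output, 1 the simulated machine for \<open>J\<close>, 2 the arguments
  and results of the coding programs, 3 the machine that is iterated, 4 and 5 further simulated
  machines, 6 the bookkeeping of the stack evaluation, and 7 the index of the current iterate.
\<close>

type_synonym var = "nat \<times> nat"
type_synonym store = "var \<Rightarrow> nat"

datatype com =
    Skip
  | Zero var
  | Inc var
  | Assign var var
  | Ask var
  | Seq com com (infixr ";;" 60)
  | Cond var var com com
  | Loop var var com

inductive run :: "baire \<Rightarrow> com \<Rightarrow> store \<Rightarrow> store \<Rightarrow> bool" for p where
  "run p Skip s s"
| "run p (Zero v) s (s(v := 0))"
| "run p (Inc v) s (s(v := Suc (s v)))"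
| "run p (Assign v w) s (s(v := s w))"
| "run p (Ask v) s (s(v := p (s v)))"
| "run p c s t \<Longrightarrow> run p d t u \<Longrightarrow> run p (c ;; d) s u"
| "s v = s w \<Longrightarrow> run p c s t \<Longrightarrow> run p (Cond v w c d) s t"
| "s v \<noteq> s w \<Longrightarrow> run p d s t \<Longrightarrow> run p (Cond v w c d) s t"
| "s v = s w \<Longrightarrow> run p (Loop v w c) s s"
| "s v \<noteq> s w \<Longrightarrow> run p c s t \<Longrightarrow> run p (Loop v w c) t u \<Longrightarrow> run p (Loop v w c) s u"

inductive_cases run_SkipE: "run p Skip s t"
  and run_ZeroE: "run p (Zero v) s t"
  and run_IncE: "run p (Inc v) s t"
  and run_AssignE: "run p (Assign v w) s t"
  and run_AskE: "run p (Ask v) s t"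
  and run_SeqE: "run p (c ;; d) s t"
  and run_CondE: "run p (Cond v w c d) s t"
  and run_LoopE: "run p (Loop v w c) s t"

definition wp :: "baire \<Rightarrow> com \<Rightarrow> (store \<Rightarrow> bool) \<Rightarrow> store \<Rightarrow> bool" where
  "wp p c Q s \<longleftrightarrow> (\<exists>t. run p c s t \<and> Q t)"

lemma wp_simps [simp]:
  "wp p Skip Q s = Q s"
  "wp p (Zero v) Q s = Q (s(v := 0))"
  "wp p (Inc v) Q s = Q (s(v := Suc (s v)))"
  "wp p (Assign v w) Q s = Q (s(v := s w))"
  "wp p (Ask v) Q s = Q (s(v := p (s v)))"
  "wp p (c ;; d) Q s = wp p c (wp p d Q) s"
  "wp p (Cond v w c d) Q s = (if s v = s w then wp p c Q s else wp p d Q s)"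
  unfolding wp_def
  by (auto intro: run.intros elim: run_SkipE run_ZeroE run_IncE run_AssignE run_AskE)
     (blast intro: run.intros elim: run_SeqE run_CondE)+

text \<open>
  As a rewrite rule this unfolding would not terminate, so it is applied by hand in inductions on
  the number of remaining rounds.
\<close>

lemma wp_Loop:
  "wp p (Loop v w c) Q s = (if s v = s w then Q s else wp p c (wp p (Loop v w c) Q) s)"
  unfolding wp_def by (auto intro: run.intros elim: run_LoopE)

lemma wp_mono:
  assumes "wp p c Q s" and "\<And>t. Q t \<Longrightarrow> Q' t"
  shows "wp p c Q' s"
  using assms unfolding wp_def by blast

section \<open>Compilation to register machines\<close>

text \<open>
  The pairing function \<open>prod_encode\<close> is a bijection with value 0 at \<open>(0, 0)\<close>. Hence stores and
  register contents correspond exactly, and the variable \<open>(0, 0)\<close> is the register in which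
  machines expect their input and leave their output.
\<close>

abbreviation (input) reg :: "var \<Rightarrow> nat" where
  "reg \<equiv> prod_encode"

fun code_size :: "com \<Rightarrow> nat" where
  "code_size Skip = 0"
| "code_size (c ;; d) = code_size c + code_size d"
| "code_size (Cond v w c d) = Suc (code_size d + Suc (code_size c))"
| "code_size (Loop v w c) = Suc (code_size c + 1)"
| "code_size _ = 1"

text \<open>
  The first argument is the address at which the code is going to be placed; jump targets are
  absolute. The jump comparing register 0 with itself is unconditional.
\<close>

fun compile :: "nat \<Rightarrow> com \<Rightarrow> instr list" where
  "compile a Skip = []"
| "compile a (Zero v) = [Clear (reg v)]"
| "compile a (Inc v) = [Incr (reg v)]"
| "compile a (Assign v w) = [Copy (reg w) (reg v)]"
| "compile a (Ask v) = [Query (reg v)]"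
| "compile a (c ;; d) = compile a c @ compile (a + code_size c) d"
| "compile a (Cond v w c d) =
    (let b = Suc (a + code_size d) in
     JumpEq (reg v) (reg w) (Suc b) # compile (Suc a) d
     @ JumpEq 0 0 (Suc b + code_size c) # compile (Suc b) c)"
| "compile a (Loop v w c) =
    JumpEq (reg v) (reg w) (Suc (Suc (a + code_size c))) # compile (Suc a) c @ [JumpEq 0 0 a]"

lemma length_compile [simp]: "length (compile a c) = code_size c"
  by (induction c arbitrary: a) (auto simp: Let_def)

definition reaches :: "instr list \<Rightarrow> baire \<Rightarrow> config \<Rightarrow> config \<Rightarrow> bool" where
  "reaches P p c c' \<longleftrightarrow> (\<exists>n. (machine_step P p ^^ n) c = c')"

lemma reaches_refl: "reaches P p c c"
  unfolding reaches_def by (rule exI[of _ 0]) simp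

lemma reaches_trans: "reaches P p c c' \<Longrightarrow> reaches P p c' c'' \<Longrightarrow> reaches P p c c''"
  unfolding reaches_def by (metis funpow_add comp_apply)

lemma reaches_step: "reaches P p (machine_step P p c) c' \<Longrightarrow> reaches P p c c'"
  unfolding reaches_def by (metis funpow.simps(2) funpow_swap1 comp_apply)

definition regs_of :: "store \<Rightarrow> nat \<Rightarrow> nat" where
  "regs_of s = s \<circ> prod_decode"

lemma regs_of_encode [simp]: "regs_of s (prod_encode v) = s v"
  by (simp add: regs_of_def)

lemma regs_of_upd: "regs_of (s(v := x)) = (regs_of s)(prod_encode v := x)"
  by (auto simp: regs_of_def fun_eq_iff)

text \<open>
  The code may stand anywhere in a longer program, since the induction has to apply the statement
  to the code of subprograms.
\<close>

lemma compile_correct: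
  assumes "run p c s t" and "P = xs @ compile (length xs) c @ ys"
  shows "reaches P p (length xs, regs_of s) (length xs + code_size c, regs_of t)"
  using assms
proof (induction arbitrary: xs ys)
  case (1 s)
  then show ?case by (simp add: reaches_refl)
next
  case (6 c s t d u)
  from "6.IH"(1)[of xs "compile (length xs + code_size c) d @ ys"] "6.prems"
  have "reaches P p (length xs, regs_of s) (length xs + code_size c, regs_of t)" by simp
  moreover from "6.IH"(2)[of "xs @ compile (length xs) c" ys] "6.prems"
  have "reaches P p (length xs + code_size c, regs_of t)
     (length xs + code_size c + code_size d, regs_of u)" by simp
  ultimately show ?case by (auto intro: reaches_trans simp: add.assoc)
next
  case (7 s v w c t d)
  let ?b = "Suc (length xs + code_size d)"
  from "7.IH"[of "xs @ JumpEq (reg v) (reg w) (Suc ?b) # compile (Suc (length xs)) d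
      @ [JumpEq 0 0 (Suc ?b + code_size c)]" ys] "7.prems"
  have "reaches P p (Suc ?b, regs_of s) (Suc ?b + code_size c, regs_of t)"
    by (simp add: Let_def)
  then show ?case
    using "7.prems" "7.hyps" by - (rule reaches_step, auto simp: machine_step_def nth_append Let_def
        add.assoc)
next
  case (8 s v w d t c)
  let ?b = "Suc (length xs + code_size d)"
  from "8.IH"[of "xs @ [JumpEq (reg v) (reg w) (Suc ?b)]"
     "JumpEq 0 0 (Suc ?b + code_size c) # compile (Suc ?b) c @ ys"] "8.prems"
  have 1: "reaches P p (Suc (length xs), regs_of s) (?b, regs_of t)"
    by (simp add: Let_def)
  have "P ! ?b = JumpEq 0 0 (Suc ?b + code_size c)" "?b < length P"
    using "8.prems" by (simp_all add: nth_append Let_def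
        add.assoc)
  then have "reaches P p (?b, regs_of t) (Suc ?b + code_size c, regs_of t)"
    by - (rule reaches_step, simp add: machine_step_def reaches_refl)
  with 1 have "reaches P p (Suc (length xs), regs_of s) (Suc ?b + code_size c, regs_of t)"
    by (rule reaches_trans)
  then show ?case
    using "8.prems" "8.hyps" by - (rule reaches_step, auto simp: machine_step_def nth_append Let_def
        add.assoc)
next
  case (9 s v w c)
  then show ?case
    by - (rule reaches_step, auto simp: machine_step_def nth_append reaches_refl)
next
  case (10 s v w c t u)
  let ?b = "Suc (length xs + code_size c)"
  from "10.IH"(1)[of "xs @ [JumpEq (reg v) (reg w) (Suc ?b)]" "JumpEq 0 0 (length xs) # ys"] "10.prems"
  have 1: "reaches P p (Suc (length xs), regs_of s) (?b, regs_of t)" by simp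
  have "P ! ?b = JumpEq 0 0 (length xs)" "?b < length P"
    using "10.prems" by (simp_all add: nth_append)
  then have "reaches P p (?b, regs_of t) (length xs + code_size (Loop v w c), regs_of u)"
    using "10.IH"(2)[OF "10.prems"] by - (rule reaches_step, simp add: machine_step_def)
  with 1 have "reaches P p (Suc (length xs), regs_of s)
      (length xs + code_size (Loop v w c), regs_of u)"
    by (rule reaches_trans)
  then show ?case
    using "10.prems" "10.hyps" by - (rule reaches_step, auto simp: machine_step_def nth_append)
qed (rule reaches_step, simp add: machine_step_def nth_append reaches_refl regs_of_upd)+

definition input_store :: "nat \<Rightarrow> store" where
  "input_store k = (\<lambda>_. 0)((0, 0) := k)"

text \<open>
  The passage from structured programs to machines: from here on a function is shown to be
  computable by exhibiting a structured program.
\<close>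

lemma computable_baireI:
  assumes "\<And>p q k. \<gamma> p = Some q \<Longrightarrow> wp p c (\<lambda>t. t (0, 0) = q k) (input_store k)"
  shows "computable_baire \<gamma>"
  unfolding computable_baire_def
proof (intro exI allI impI)
  fix p q k assume "\<gamma> p = Some q"
  then obtain t where t: "run p c (input_store k) t" "t (0, 0) = q k"
    using assms unfolding wp_def by blast
  have d0: "prod_decode 0 = (0, 0)"
    by (simp add: prod_decode_def prod_decode_aux.simps)
  have *: "initial_regs [k] = regs_of (input_store k)"
  proof
    fix i
    show "initial_regs [k] i = (regs_of (input_store k)) i"
    proof (cases "i = 0")
      case False
      then have "prod_decode i \<noteq> (0, 0)"
        by (metis d0 prod_decode_inverse)
      with False show ?thesis by (simp add: initial_regs_def input_store_def regs_of_def)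
    qed (simp add: initial_regs_def input_store_def regs_of_def d0)
  qed
  have "reaches (compile 0 c) p (0, initial_regs [k]) (code_size c, regs_of t)"
    using compile_correct[OF t(1), of "compile 0 c" "[]" "[]"] unfolding * by simp
  then show "machine_outputs (compile 0 c) p [k] (q k)"
    unfolding machine_outputs_def reaches_def using t(2) d0 by (fastforce simp: regs_of_def)
qed

section \<open>Running a machine on a simulated oracle\<close>

fun registers :: "instr \<Rightarrow> nat set" where
  "registers (Clear i) = {i}"
| "registers (Incr i) = {i}"
| "registers (Copy i j) = {i, j}"
| "registers (JumpEq i j t) = {i, j}"
| "registers (Query i) = {i}"

text \<open>
  Every register of the program, and register 0 for the output, has a number below this bound; so
  finitely many variables suffice to simulate the program.
\<close>

definition width :: "instr list \<Rightarrow> nat" where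
  "width P = Suc (Max (insert 0 (\<Union>(registers ` set P))))"

lemma width_pos [simp]: "0 < width P"
  by (simp add: width_def)

lemma register_less_width: "ins \<in> set P \<Longrightarrow> i \<in> registers ins \<Longrightarrow> i < width P"
proof -
  have "finite (registers ins)" for ins by (cases ins) auto
  moreover assume "ins \<in> set P" "i \<in> registers ins"
  ultimately show ?thesis
    unfolding width_def less_Suc_eq_le by (intro Max_ge) auto
qed

text \<open>
  The layout of a block in which a machine is simulated: program counter, program length, a
  scratch variable, and then the registers of the machine.
\<close>

abbreviation pcv :: "nat \<Rightarrow> var" where "pcv b \<equiv> (b, 0)"
abbreviation lenv :: "nat \<Rightarrow> var" where "lenv b \<equiv> (b, Suc 0)"
abbreviation tmpv :: "nat \<Rightarrow> var" where "tmpv b \<equiv> (b, Suc (Suc 0))"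
abbreviation rg :: "nat \<Rightarrow> nat \<Rightarrow> var" where "rg b i \<equiv> (b, Suc (Suc (Suc i)))"

definition agree_off :: "nat set \<Rightarrow> store \<Rightarrow> store \<Rightarrow> bool" where
  "agree_off B s t \<longleftrightarrow> (\<forall>v. fst v \<notin> B \<longrightarrow> t v = s v)"

fun Const :: "var \<Rightarrow> nat \<Rightarrow> com" where
  "Const v 0 = Zero v"
| "Const v (Suc n) = Const v n ;; Inc v"

lemma wp_Const [simp]: "wp p (Const v n) Q s = Q (s(v := n))"
  by (induction n arbitrary: Q) auto

fun Zeros :: "var list \<Rightarrow> com" where
  "Zeros [] = Skip"
| "Zeros (v # vs) = Zero v ;; Zeros vs"

lemma wp_Zeros [simp]: "wp p (Zeros vs) Q s = Q (\<lambda>v. if v \<in> set vs then 0 else s v)"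
proof (induction vs arbitrary: s)
  case (Cons v vs)
  have "(\<lambda>u. if u \<in> set vs then 0 else (s(v := 0)) u) = (\<lambda>u. if u \<in> set (v # vs) then 0 else s u)"
    by auto
  then show ?case using Cons by simp
qed simp

text \<open>
  A program counter is a datum of the simulation, so executing the instruction that it points at
  is a case distinction: the scratch variable runs through the addresses until it meets the
  counter.
\<close>

fun Select :: "nat \<Rightarrow> nat \<Rightarrow> com list \<Rightarrow> com \<Rightarrow> com" where
  "Select b j [] d = d"
| "Select b j (c # cs) d =
    Const (tmpv b) j ;; Cond (pcv b) (tmpv b) c (Select b (Suc j) cs d)"

lemma wp_Select:
  assumes "j \<le> s (pcv b)"
    and "s (pcv b) < j + length cs \<Longrightarrow> wp p (cs ! (s (pcv b) - j)) Q (s(tmpv b := s (pcv b)))"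
    and "\<And>x. j + length cs \<le> s (pcv b) \<Longrightarrow> wp p d Q (s(tmpv b := x))"
  shows "wp p (Select b j cs d) Q s"
  using assms
proof (induction cs arbitrary: j s)
  case Nil
  then show ?case using Nil(3)[of "s (tmpv b)"] by simp
next
  case (Cons c cs)
  show ?case
  proof (cases "s (pcv b) = j")
    case True
    then show ?thesis using Cons.prems(2) by (auto simp: fun_upd_def)
  next
    case False
    then have "wp p (Select b (Suc j) cs d) Q (s(tmpv b := j))"
      using Cons.prems by (intro Cons.IH) (auto simp: nth_Cons' fun_upd_def cong: if_cong)
    with False show ?thesis by auto
  qed
qed

text \<open>
  What a query means is left to the parameter: the various simulations differ only there. Jump
  targets are cut off at the program length \<open>n\<close>, so that the halting states of the machine
  become the single value \<open>n\<close> of the program counter.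
\<close>

fun Instr :: "nat \<Rightarrow> nat \<Rightarrow> (nat \<Rightarrow> com) \<Rightarrow> instr \<Rightarrow> com" where
  "Instr b n ask (Clear i) = Zero (rg b i) ;; Inc (pcv b)"
| "Instr b n ask (Incr i) = Inc (rg b i) ;; Inc (pcv b)"
| "Instr b n ask (Copy i j) = Assign (rg b j) (rg b i) ;; Inc (pcv b)"
| "Instr b n ask (JumpEq i j t) = Cond (rg b i) (rg b j) (Const (pcv b) (min t n)) (Inc (pcv b))"
| "Instr b n ask (Query i) = ask i"

definition holds :: "nat \<Rightarrow> instr list \<Rightarrow> config \<Rightarrow> store \<Rightarrow> bool" where
  "holds b P c s \<longleftrightarrow> s (lenv b) = length P \<and> s (pcv b) = min (fst c) (length P)
     \<and> (\<forall>i < width P. s (rg b i) = snd c i)"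

lemma holds_tmpv [simp]: "holds b P c (s(tmpv b := x)) = holds b P c s"
  by (simp add: holds_def)

text \<open>
  The oracle \<open>q\<close> of the simulated machine and the oracle \<open>p\<close> of the simulating program are
  different in general; without a query neither is consulted.
\<close>

lemma wp_Instr:
  assumes "holds b P (pc, R) s" "pc < length P" "\<And>i. P ! pc \<noteq> Query i"
  shows "wp p (Instr b (length P) ask (P ! pc))
    (\<lambda>t. holds b P (exec_instr q (P ! pc) (pc, R)) t \<and> agree_off {b} s t) s"
proof -
  have *: "i \<in> registers (P ! pc) \<Longrightarrow> s (rg b i) = R i" for i
    using assms(1) register_less_width[OF nth_mem[OF assms(2)], of i] by (simp add: holds_def)
  show ?thesis
    using assms * by (cases "P ! pc") (auto simp: holds_def agree_off_def)
qed

text \<open>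
  The machine finds its \<open>a\<close> arguments already in its first registers. The other registers are
  cleared because the block may contain the remains of an earlier run.
\<close>

definition Call :: "nat \<Rightarrow> instr list \<Rightarrow> nat \<Rightarrow> (nat \<Rightarrow> com) \<Rightarrow> com" where
  "Call b P a ask =
     Const (lenv b) (length P) ;; Zero (pcv b) ;; Zeros (map (rg b) [a..<width P]) ;;
     Loop (pcv b) (lenv b)
       (Select b 0 (map (Instr b (length P) (\<lambda>i. ask i ;; Inc (pcv b))) P) Skip)"

lemma agree_off_trans:
  "agree_off B s t \<Longrightarrow> agree_off B' t u \<Longrightarrow> B \<subseteq> C \<Longrightarrow> B' \<subseteq> C \<Longrightarrow> agree_off C s u"
  unfolding agree_off_def by (metis subsetD)

lemma agree_offD: "agree_off B s t \<Longrightarrow> fst v \<notin> B \<Longrightarrow> t v = s v"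
  by (simp add: agree_off_def del: split_paired_All)

text \<open>
  A machine can be run on any oracle \<open>q\<close> of which a subprogram can compute the requested entries;
  this is how oracles that are themselves outputs of machines are handled. The subprogram may use
  the blocks in \<open>B\<close>, and may rely on everything outside these and the block of the simulation being
  as it was at the start.
\<close>

lemma wp_Call:
  assumes out: "machine_outputs P q ks x"
    and args: "\<And>i. i < length ks \<Longrightarrow> s0 (rg b i) = ks ! i"
    and "b \<notin> B"
    and ask: "\<And>s i. agree_off (insert b B) s0 s \<Longrightarrow>
       wp p (ask i) (\<lambda>t. \<exists>u. t = u(rg b i := q (s (rg b i))) \<and> agree_off B s u) s"
  shows "wp p (Call b P (length ks) ask) (\<lambda>t. t (rg b 0) = x \<and> agree_off (insert b B) s0 t) s0"
proof -
  let ?body = "Select b 0 (map (Instr b (length P) (\<lambda>i. ask i ;; Inc (pcv b))) P) Skip"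
  let ?Q = "\<lambda>t. t (rg b 0) = x \<and> agree_off (insert b B) s0 t"
  \<comment> \<open>Induction on the number of machine steps; each one before the machine halts is one round.\<close>
  have loop: "wp p (Loop (pcv b) (lenv b) ?body) ?Q s"
    if "(machine_step P q ^^ n) c = (pc', R')" "length P \<le> pc'" "R' 0 = x"
      "holds b P c s" "agree_off (insert b B) s0 s" for n c s pc' R'
    using that
  proof (induction n arbitrary: c s)
    case 0
    then show ?case by (simp add: wp_Loop holds_def)
  next
    case (Suc n)
    obtain pc R where c: "c = (pc, R)" by fastforce
    show ?case
    proof (cases "pc < length P")
      case False
      then have "machine_step P q c = c" by (simp add: machine_step_def c)
      then show ?thesis using Suc by (simp add: funpow_swap1)
    next
      case True
      let ?c' = "exec_instr q (P ! pc) (pc, R)"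
      have c': "(machine_step P q ^^ n) ?c' = (pc', R')"
      proof -
        have "machine_step P q c = ?c'" using True by (simp add: machine_step_def c)
        then show ?thesis using Suc.prems(1) by (simp add: funpow_swap1)
      qed
      have pcv: "s (pcv b) = pc" and lenv: "s (lenv b) = length P"
        using Suc.prems(4) True by (auto simp: holds_def c)
      let ?s = "s(tmpv b := pc)"
      have ag: "agree_off (insert b B) s0 ?s" and h: "holds b P (pc, R) ?s"
        using Suc.prems(4,5) by (auto simp: c agree_off_def)
      have "wp p (Instr b (length P) (\<lambda>i. ask i ;; Inc (pcv b)) (P ! pc))
              (\<lambda>t. holds b P ?c' t \<and> agree_off (insert b B) s0 t) ?s"
      proof (cases "\<exists>i. P ! pc = Query i")
        case False
        then show ?thesis
          by (intro wp_mono[OF wp_Instr[OF h True]]) (auto intro: agree_off_trans[OF ag])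
      next
        case True
        then obtain i where i: "P ! pc = Query i" by blast
        have iw: "i < width P"
          using register_less_width[OF nth_mem[OF \<open>pc < length P\<close>], of i] by (simp add: i)
        have Ri: "s (rg b i) = R i" using iw h by (simp add: holds_def)
        have "wp p (ask i) (wp p (Inc (pcv b))
              (\<lambda>t. holds b P ?c' t \<and> agree_off (insert b B) s0 t)) ?s"
        proof (rule wp_mono[OF ask[OF ag]])
          fix t assume "\<exists>u. t = u(rg b i := q (?s (rg b i))) \<and> agree_off B ?s u"
          then obtain u where u: "t = u(rg b i := q (?s (rg b i)))" "agree_off B ?s u" by blast
          from u(2) \<open>b \<notin> B\<close> have eq: "u (b, j) = ?s (b, j)" for j by (simp add: agree_off_def)
          have "holds b P ?c' (t(pcv b := Suc (t (pcv b))))"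
            using h iw \<open>pc < length P\<close> Ri by (auto simp: holds_def u(1) eq i)
          moreover have "agree_off (insert b B) s0 (t(pcv b := Suc (t (pcv b))))"
            using ag u(2) by (auto simp: agree_off_def u(1))
          ultimately show "wp p (Inc (pcv b))
              (\<lambda>t. holds b P ?c' t \<and> agree_off (insert b B) s0 t) t" by simp
        qed
        then show ?thesis by (simp add: i)
      qed
      then have "wp p (Instr b (length P) (\<lambda>i. ask i ;; Inc (pcv b)) (P ! pc))
              (wp p (Loop (pcv b) (lenv b) ?body) ?Q) ?s"
        by (rule wp_mono) (use Suc.IH[OF c' Suc.prems(2,3)] in blast)
      then have "wp p ?body (wp p (Loop (pcv b) (lenv b) ?body) ?Q) s"
        using True by (intro wp_Select) (auto simp: pcv)
      then show ?thesis
        using True pcv lenv by (subst wp_Loop) auto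
    qed
  qed
  let ?s1 = "\<lambda>v. if v \<in> set (map (rg b) [length ks..<width P]) then 0
     else (s0(lenv b := length P, pcv b := 0)) v"
  obtain n pc' R' where "(machine_step P q ^^ n) (0, initial_regs ks) = (pc', R')"
      "length P \<le> pc'" "R' 0 = x"
    using out unfolding machine_outputs_def by blast
  moreover have "holds b P (0, initial_regs ks) ?s1"
    using args by (auto simp: holds_def initial_regs_def)
  moreover have "agree_off (insert b B) s0 ?s1"
    by (auto simp: agree_off_def)
  ultimately have "wp p (Loop (pcv b) (lenv b) ?body) ?Q ?s1"
    by (rule loop)
  then show ?thesis
    unfolding Call_def by (simp del: set_map)
qed

section \<open>Coding of pairs and stacks\<close>

lemma wp_Call_oracle:
  assumes "machine_outputs P p ks x"
    and "\<And>i. i < length ks \<Longrightarrow> s (rg b i) = ks ! i"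
  shows "wp p (Call b P (length ks) (\<lambda>i. Ask (rg b i)))
    (\<lambda>t. t (rg b 0) = x \<and> agree_off {b} s t) s"
  using assms by (rule wp_Call[where B = "{}"]) (auto simp: agree_off_def)

text \<open>
  Fixed argument and result variables of the coding programs: a code is \<open>wholev\<close> when it is an
  argument and \<open>codev\<close> when it is a result.
\<close>

abbreviation (input) leftv :: var where "leftv \<equiv> (2, 0)"
abbreviation (input) rightv :: var where "rightv \<equiv> (2, Suc 0)"
abbreviation (input) codev :: var where "codev \<equiv> (2, 2)"
abbreviation (input) countv :: var where "countv \<equiv> (2, 3)"
abbreviation (input) wholev :: var where "wholev \<equiv> (2, 4)"
abbreviation (input) zerov :: var where "zerov \<equiv> (2, 5)"

lemma wp_double:
  assumes "s countv \<le> s w" "s codev = 2 * s countv + 1" "w \<noteq> codev" "w \<noteq> countv"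
    and "Q (s(countv := s w, codev := 2 * s w + 1))"
  shows "wp p (Loop countv w (Inc countv ;; Inc codev ;; Inc codev)) Q s"
  using assms
proof (induction "s w - s countv" arbitrary: s)
  case 0
  then have eq: "s countv = s w" by simp
  then have "s(countv := s w, codev := 2 * s w + 1) = s" using 0 by (simp add: fun_eq_iff)
  then have "Q s" using "0.prems"(5) by (simp only:)
  with eq show ?case by (simp add: wp_Loop)
next
  case (Suc n)
  let ?s = "s(countv := Suc (s countv), codev := Suc (Suc (s codev)))"
  have "wp p (Loop countv w (Inc countv ;; Inc codev ;; Inc codev)) Q ?s"
    using Suc.hyps(2) Suc.prems by (intro Suc.hyps(1)) (auto simp: fun_upd_twist)
  then show ?case
    using Suc.hyps(2) by (subst wp_Loop) (auto simp: fun_upd_twist)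
qed

definition Parity :: com where
  "Parity = Zero codev ;; Zero countv ;; Zero zerov ;;
     Loop countv wholev (Inc countv ;; Cond codev zerov (Inc codev) (Zero codev))"

lemma wp_Parity:
  "wp p Parity (\<lambda>t. t codev = s wholev mod 2 \<and> t wholev = s wholev \<and> agree_off {2} s t) s"
proof -
  have "wp p (Loop countv wholev (Inc countv ;; Cond codev zerov (Inc codev) (Zero codev)))
      (\<lambda>t. t codev = s wholev mod 2 \<and> t wholev = s wholev \<and> agree_off {2} s t) u"
    if "u countv \<le> u wholev" "u codev = u countv mod 2" "u zerov = 0" "u wholev = s wholev"
      "agree_off {2} s u" for u
    using that
  proof (induction "u wholev - u countv" arbitrary: u)
    case 0
    then show ?case by (simp add: wp_Loop)
  next
    case (Suc n)
    have "u codev = 0 \<or> u codev = 1" using Suc.prems(2) by linarith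
    moreover have "agree_off {2} s (u(v := x, w := y))" if "fst v = 2" "fst w = 2" for v w x y
      using that Suc.prems(5) by (auto simp: agree_off_def)
    ultimately show ?case
      using Suc.hyps(2) Suc.prems(1-4)
      by (subst wp_Loop) (auto simp del: mod_by_Suc_0 intro!: Suc.hyps(1) simp: mod_Suc)
  qed
  then show ?thesis by (auto simp: Parity_def agree_off_def)
qed

locale computable_pairing =
  fixes J :: "nat \<times> nat \<Rightarrow> nat" and PJ :: "instr list"
  assumes inj_J: "inj J"
    and J_ge: "max m n \<le> J (m, n)"
    and PJ: "machine_outputs PJ p [m, n] (J (m, n))"
begin

text \<open>
  The pairing by which a name of a pair is formed, entry by entry, from names of its components.
\<close>

definition E :: "nat \<Rightarrow> nat \<Rightarrow> nat" where
  "E m n = 2 * J (m, n) + 1"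

lemma E_inject [simp]: "E m n = E m' n' \<longleftrightarrow> m = m' \<and> n = n'"
  using inj_J by (auto simp: E_def dest: injD)

lemma le_E: "m \<le> E m n" "n \<le> E m n"
  using J_ge[of m n] by (auto simp: E_def)

definition Enc :: com where
  "Enc = Assign (rg 1 0) leftv ;; Assign (rg 1 1) rightv ;; Call 1 PJ 2 (\<lambda>i. Ask (rg 1 i)) ;;
     Zero countv ;; Const codev 1 ;; Loop countv (rg 1 0) (Inc countv ;; Inc codev ;; Inc codev)"

lemma wp_Enc:
  "wp p Enc (\<lambda>t. t codev = E (s leftv) (s rightv) \<and> t leftv = s leftv \<and> t rightv = s rightv
      \<and> t wholev = s wholev \<and> agree_off {1, 2} s t) s"
proof -
  let ?s = "s(rg 1 0 := s leftv, rg 1 1 := s rightv)"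
  have "wp p (Call 1 PJ (length [s leftv, s rightv]) (\<lambda>i. Ask (rg 1 i)))
    (\<lambda>t. t (rg 1 0) = J (s leftv, s rightv) \<and> agree_off {1} ?s t) ?s"
    by (rule wp_Call_oracle[OF PJ]) (auto simp: less_Suc_eq)
  then have "wp p (Call 1 PJ 2 (\<lambda>i. Ask (rg 1 i)))
    (\<lambda>t. t (rg 1 0) = J (s leftv, s rightv) \<and> agree_off {1} ?s t) ?s"
    by (simp add: numeral_2_eq_2)
  then show ?thesis
    unfolding Enc_def by (auto simp: agree_off_def E_def intro!: wp_double elim!: wp_mono)
qed

text \<open>
  Search through the pairs \<open>(x, y)\<close> in lexicographic order, starting a new row as soon as \<open>y\<close>
  has reached the code itself: components never exceed their code, so no candidate is missed.
\<close>

definition Dec :: com where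
  "Dec = Zero leftv ;; Zero rightv ;; Enc ;;
     Loop codev wholev (Cond rightv wholev (Inc leftv ;; Zero rightv) (Inc rightv) ;; Enc)"

lemma wp_Dec:
  assumes "s wholev = E a b"
  shows "wp p Dec (\<lambda>t. t leftv = a \<and> t rightv = b \<and> agree_off {1, 2} s t) s"
proof -
  let ?c = "Cond rightv wholev (Inc leftv ;; Zero rightv) (Inc rightv) ;; Enc"
  let ?Q = "\<lambda>t. t leftv = a \<and> t rightv = b \<and> agree_off {1, 2} s t"
  have loop: "wp p (Loop codev wholev ?c) ?Q u"
    if "u codev = E (u leftv) (u rightv)" "u wholev = E a b" "agree_off {1, 2} s u"
      "u leftv < a \<and> u rightv \<le> E a b \<or> u leftv = a \<and> u rightv \<le> b" for u
    using that
  \<comment> \<open>The measure bounds the number of candidates left, with rows of \<open>E a b + 1\<close> entries each.\<close>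
  proof (induction "(a - u leftv) * Suc (E a b) + (E a b - u rightv)" arbitrary: u
        rule: less_induct)
    case less
    show ?case
    proof (cases "u leftv = a \<and> u rightv = b")
      case True
      then show ?thesis using less.prems by (subst wp_Loop) simp
    next
      case False
      define x y where "x = (if u rightv = E a b then Suc (u leftv) else u leftv)"
        and "y = (if u rightv = E a b then 0 else Suc (u rightv))"
      have xy: "x < a \<and> y \<le> E a b \<or> x = a \<and> y \<le> b"
        using less.prems(4) False le_E[where m = a and n = b] by (auto simp: x_def y_def)
      have dec: "(a - x) * Suc (E a b) + (E a b - y)
          < (a - u leftv) * Suc (E a b) + (E a b - u rightv)"
      proof (cases "u rightv = E a b")
        case True
        then have "u leftv < a" using less.prems(4) False le_E[where m = a and n = b] by auto
        then have "a - u leftv = Suc (a - x)" by (simp add: x_def True)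
        then show ?thesis by (simp add: True)
      next
        case False
        then have "u rightv < E a b" using less.prems(4) le_E[where m = a and n = b] by auto
        then show ?thesis by (simp add: x_def y_def False)
      qed
      let ?u = "u(leftv := x, rightv := y)"
      have "wp p Enc (wp p (Loop codev wholev ?c) ?Q) ?u"
      proof (rule wp_mono[OF wp_Enc])
        fix t assume "t codev = E (?u leftv) (?u rightv) \<and> t leftv = ?u leftv \<and> t rightv = ?u rightv
          \<and> t wholev = ?u wholev \<and> agree_off {1, 2} ?u t"
        then have t: "t codev = E x y" "t leftv = x" "t rightv = y" "t wholev = E a b"
          and ag: "agree_off {1, 2} ?u t" using less.prems(2) by auto
        have "agree_off {1, 2} s t" using ag less.prems(3) by (auto simp: agree_off_def)
        then show "wp p (Loop codev wholev ?c) ?Q t"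
          using t xy dec by (intro less.hyps) auto
      qed
      then have "wp p ?c (wp p (Loop codev wholev ?c) ?Q) u"
        using less.prems(2) by (auto simp: x_def y_def)
      then show ?thesis
        using less.prems(1,2) False by (subst wp_Loop) auto
    qed
  qed
  let ?u = "s(leftv := 0, rightv := 0)"
  have "wp p Enc (wp p (Loop codev wholev ?c) ?Q) ?u"
    by (rule wp_mono[OF wp_Enc], rule loop) (use assms in \<open>auto simp: agree_off_def\<close>)
  then show ?thesis by (simp add: Dec_def)
qed

text \<open>
  A stack is a nested pair with the top on the left; popping a list of variables restores them in
  the order opposite to that in which they were pushed.
\<close>

fun Push :: "var \<Rightarrow> var list \<Rightarrow> com" where
  "Push S [] = Skip"
| "Push S (v # vs) = Assign leftv v ;; Assign rightv S ;; Enc ;; Assign S codev ;; Push S vs"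

fun Pop :: "var \<Rightarrow> var list \<Rightarrow> com" where
  "Pop S [] = Skip"
| "Pop S (v # vs) = Pop S vs ;; Assign wholev S ;; Dec ;; Assign v leftv ;; Assign S rightv"

definition stack :: "(var \<Rightarrow> nat) \<Rightarrow> var list \<Rightarrow> nat \<Rightarrow> nat" where
  "stack f vs x = foldl (\<lambda>y v. E (f v) y) x vs"

lemma wp_Push:
  assumes "\<And>v. v \<in> insert S (set vs) \<Longrightarrow> fst v \<notin> {1, 2}" "S \<notin> set vs"
  shows "wp p (Push S vs) (\<lambda>t. t S = stack s vs (s S)
      \<and> (\<forall>v. fst v \<notin> {1, 2} \<and> v \<noteq> S \<longrightarrow> t v = s v)) s"
  using assms
proof (induction vs arbitrary: s)
  case Nil
  then show ?case by (simp add: stack_def)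
next
  case (Cons v vs)
  let ?Q = "\<lambda>t. t S = stack s (v # vs) (s S) \<and> (\<forall>v. fst v \<notin> {1, 2} \<and> v \<noteq> S \<longrightarrow> t v = s v)"
  let ?s = "s(leftv := s v, rightv := s S)"
  have S: "fst S \<notin> {1, 2}" and v: "fst v \<notin> {1, 2}" using Cons.prems by auto
  have "wp p Enc (wp p (Assign S codev ;; Push S vs) ?Q) ?s"
  proof (rule wp_mono[OF wp_Enc])
    fix t assume "t codev = E (?s leftv) (?s rightv) \<and> t leftv = ?s leftv \<and> t rightv = ?s rightv
          \<and> t wholev = ?s wholev \<and> agree_off {1, 2} ?s t"
    then have t: "t codev = E (s v) (s S)" "agree_off {1, 2} s t" by (auto simp: agree_off_def)
    let ?t = "t(S := E (s v) (s S))"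
    have "?t u = s u" if "u \<in> set vs" for u
      using Cons.prems(1)[of u] Cons.prems(2) agree_offD[OF t(2), of u] that by auto
    then have st: "stack ?t vs x = stack s vs x" for x
      unfolding stack_def by (intro foldl_cong) auto
    have "wp p (Push S vs) ?Q ?t"
      by (rule wp_mono[OF Cons.IH])
        (use Cons.prems t st in \<open>auto simp: agree_off_def stack_def\<close>)
    then show "wp p (Assign S codev ;; Push S vs) ?Q t" by (simp add: t)
  qed
  moreover have "S \<noteq> leftv" using S by auto
  ultimately show ?case by simp
qed

lemma wp_Pop:
  assumes "\<And>v. v \<in> insert S (set vs) \<Longrightarrow> fst v \<notin> {1, 2}" "S \<notin> set vs"
    and "s S = stack f vs x"
  shows "wp p (Pop S vs) (\<lambda>t. t S = x \<and> (\<forall>v \<in> set vs. t v = f v)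
      \<and> (\<forall>v. fst v \<notin> {1, 2} \<and> v \<notin> insert S (set vs) \<longrightarrow> t v = s v)) s"
  using assms
proof (induction vs arbitrary: x)
  case Nil
  then show ?case by (simp add: stack_def)
next
  case (Cons v vs)
  let ?Q = "\<lambda>t. t S = x \<and> (\<forall>u \<in> set (v # vs). t u = f u)
      \<and> (\<forall>u. fst u \<notin> {1, 2} \<and> u \<notin> insert S (set (v # vs)) \<longrightarrow> t u = s u)"
  have S: "fst S \<notin> {1, 2}" and v: "fst v \<notin> {1, 2}" and "v \<noteq> S" using Cons.prems by auto
  have "wp p (Pop S vs) (wp p (Assign wholev S ;; Dec ;; Assign v leftv ;; Assign S rightv) ?Q) s"
  proof (rule wp_mono[OF Cons.IH])
    fix t assume t: "t S = E (f v) x \<and> (\<forall>u \<in> set vs. t u = f u)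
      \<and> (\<forall>u. fst u \<notin> {1, 2} \<and> u \<notin> insert S (set vs) \<longrightarrow> t u = s u)"
    have "wp p Dec (wp p (Assign v leftv ;; Assign S rightv) ?Q) (t(wholev := t S))"
    proof (rule wp_mono[OF wp_Dec[where a = "f v" and b = x]])
      fix t' assume t': "t' leftv = f v \<and> t' rightv = x \<and> agree_off {1, 2} (t(wholev := t S)) t'"
      have old: "t' u = t u" if "fst u \<notin> {1, 2}" for u
        using agree_offD[of "{1, 2}" "t(wholev := t S)" t' u] t' that by auto
      have "t' u = f u" if "u \<in> set vs" for u
        using old[of u] Cons.prems(1)[of u] t that by auto
      moreover have "t' u = s u" if "fst u \<notin> {1, 2}" "u \<notin> insert S (set vs)" for u
        using old[of u] t that by (auto simp del: split_paired_All)
      moreover have "v \<noteq> rightv" using v by auto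
      ultimately show "wp p (Assign v leftv ;; Assign S rightv) ?Q t'"
        using t' \<open>v \<noteq> S\<close> Cons.prems(2) by auto
    qed (use t in simp)
    then show "wp p (Assign wholev S ;; Dec ;; Assign v leftv ;; Assign S rightv) ?Q t" by simp
  qed (use Cons.prems in \<open>auto simp: stack_def\<close>)
  then show ?case by simp
qed

end

section \<open>Iterates of a machine-computable operator\<close>

context computable_pairing
begin

text \<open>
  Let \<open>q\<^bsub>i+1\<^esub>\<close> be the output of the machine \<open>P\<close> with oracle \<open>q\<^sub>i\<close>, where \<open>q\<^sub>0\<close> is the true oracle.
  Entry \<open>argv\<close> of \<open>q\<^sub>n\<close>, for \<open>n\<close> in \<open>indexv\<close>, is computed by nested runs of \<open>P\<close>. The run at
  depth \<open>d\<close>, counted from 1, computes an entry of \<open>q\<^bsub>n+1-d\<^esub>\<close> with oracle \<open>q\<^bsub>n-d\<^esub>\<close>; so the runs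
  at depth \<open>n\<close> are the ones that may ask the true oracle. The variable \<open>nilv\<close> is never written
  and supplies a zero for comparisons.
\<close>

abbreviation (input) argv :: var where "argv \<equiv> (6, 0)"
abbreviation (input) depthv :: var where "depthv \<equiv> (6, Suc 0)"
abbreviation (input) stackv :: var where "stackv \<equiv> (6, 2)"
abbreviation (input) stopv :: var where "stopv \<equiv> (6, 3)"
abbreviation (input) onev :: var where "onev \<equiv> (6, 4)"
abbreviation (input) indexv :: var where "indexv \<equiv> (7, 0)"
abbreviation (input) nilv :: var where "nilv \<equiv> (7, Suc 0)"

lemma mem_rg_image [simp]: "(c, n) \<in> rg b ` A \<longleftrightarrow> c = b \<and> (\<exists>i \<in> A. n = Suc (Suc (Suc i)))"
  by auto

definition saved :: "instr list \<Rightarrow> var list" where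
  "saved P = pcv 3 # depthv # map (rg 3) [0..<width P]"

definition New_Frame :: "instr list \<Rightarrow> com" where
  "New_Frame P = Zero (pcv 3) ;; Zeros (map (rg 3) [0..<width P]) ;; Assign (rg 3 0) argv"

text \<open>
  At smaller depths than \<open>n\<close>, a query suspends the current run, which is saved on the stack, and
  starts a new run one level deeper that has the queried position as its input.
\<close>

definition Nested_Ask :: "instr list \<Rightarrow> nat \<Rightarrow> com" where
  "Nested_Ask P i = Cond depthv indexv (Ask (rg 3 i) ;; Inc (pcv 3))
     (Assign argv (rg 3 i) ;; Push stackv (saved P) ;; Inc depthv ;; New_Frame P)"

text \<open>
  A suspended run has been saved with its program counter still at the query, so this
  instruction tells which register has to receive the answer.
\<close>

fun Resume :: "instr \<Rightarrow> com" where
  "Resume (Query i) = Assign (rg 3 i) argv ;; Inc (pcv 3)"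
| "Resume _ = Skip"

definition Return :: "instr list \<Rightarrow> com" where
  "Return P = Assign argv (rg 3 0) ;; Pop stackv (saved P) ;; Select 3 0 (map Resume P) Skip"

definition Nested_Body :: "instr list \<Rightarrow> com" where
  "Nested_Body P = Select 3 0 (map (Instr 3 (length P) (Nested_Ask P)) P)
     (Cond depthv onev (Inc stopv) (Return P))"

definition Eval_Iterate :: "instr list \<Rightarrow> com" where
  "Eval_Iterate P = Cond indexv nilv (Ask argv)
     (Const onev 1 ;; Const depthv 1 ;; Zero stopv ;; Const (lenv 3) (length P) ;; New_Frame P ;;
      Loop stopv onev (Nested_Body P) ;; Assign argv (rg 3 0))"

text \<open>
  The simulation is at depth \<open>d\<close> in machine configuration \<open>c\<close>, with the suspended runs coded by \<open>S\<close>;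
  \<open>s0\<close> is the store at the start of the whole evaluation, kept outside the blocks in use.
\<close>

definition frame :: "store \<Rightarrow> instr list \<Rightarrow> nat \<Rightarrow> nat \<Rightarrow> config \<Rightarrow> store \<Rightarrow> bool" where
  "frame s0 P d S c s \<longleftrightarrow> holds 3 P c s \<and> s depthv = d \<and> s stackv = S \<and> s stopv = 0 \<and> s onev = 1
     \<and> agree_off {1, 2, 3, 6} s0 s"

lemma holds_New_Frame:
  assumes "s (lenv 3) = length P" "s argv = x"
  shows "holds 3 P (0, initial_regs [x])
     ((\<lambda>v. if v \<in> set (map (rg 3) [0..<width P]) then 0 else (s(pcv 3 := 0)) v)(rg 3 0 := x))"
  using assms by (auto simp: holds_def initial_regs_def)

lemma frame_nested_ask:
  assumes fr: "frame s0 P d S (pc, R) s" and "pc < length P" "P ! pc = Query i" "d \<noteq> s0 indexv"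
    and Q: "\<And>t. frame s0 P (Suc d) (stack s (saved P) S) (0, initial_regs [R i]) t \<Longrightarrow> Q t"
  shows "wp p (Nested_Ask P i) Q s"
proof -
  have iw: "i < width P"
    using register_less_width[OF nth_mem[OF assms(2)], of i] by (simp add: assms)
  have indexv: "s indexv = s0 indexv" and dep: "s depthv = d"
    using fr agree_offD[of _ s0 s indexv] by (auto simp: frame_def)
  let ?s = "s(argv := s (rg 3 i))"
  have "wp p (Push stackv (saved P)) (wp p (Inc depthv ;; New_Frame P) Q) ?s"
  proof (rule wp_mono[OF wp_Push])
    fix t assume t: "t stackv = stack ?s (saved P) (?s stackv)
      \<and> (\<forall>v. fst v \<notin> {1, 2} \<and> v \<noteq> stackv \<longrightarrow> t v = ?s v)"
    have st: "stack ?s (saved P) (?s stackv) = stack s (saved P) S"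
      unfolding stack_def by (intro foldl_cong) (use fr in \<open>auto simp: saved_def frame_def\<close>)
    let ?t = "t(depthv := Suc d)"
    let ?u = "(\<lambda>v. if v \<in> set (map (rg 3) [0..<width P]) then 0 else (?t(pcv 3 := 0)) v)(rg 3 0 := R i)"
    have X: "t argv = R i" using t fr iw by (simp add: frame_def holds_def)
    have "holds 3 P (0, initial_regs [R i]) ?u"
      by (rule holds_New_Frame) (use t fr X in \<open>auto simp: frame_def holds_def\<close>)
    moreover have "agree_off {1, 2, 3, 6} s0 ?u"
      using t fr by (auto simp: agree_off_def frame_def)
    ultimately have "Q ?u"
      using t fr st by (intro Q) (auto simp: frame_def)
    then show "wp p (Inc depthv ;; New_Frame P) Q t"
      using t fr X by (simp add: New_Frame_def frame_def)
  qed (auto simp: saved_def)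
  then show ?thesis
    using dep indexv assms(4) by (simp add: Nested_Ask_def)
qed

text \<open>
  Here \<open>s\<close> is the store at which the run was suspended and \<open>s'\<close> the one at which the deeper run
  has halted. The effect on the suspended run is that of a query answered by \<open>x\<close>.
\<close>

lemma frame_return:
  assumes fr: "frame s0 P d S (pc, R) s" and "pc < length P" "P ! pc = Query i"
    and fr': "frame s0 P d' (stack s (saved P) S) c s'" and x: "s' (rg 3 0) = x"
    and Q: "\<And>t. frame s0 P d S (Suc pc, R(i := x)) t \<Longrightarrow> Q t"
  shows "wp p (Return P) Q s'"
proof -
  have iw: "i < width P"
    using register_less_width[OF nth_mem[OF assms(2)], of i] by (simp add: assms)
  let ?s = "s'(argv := x)"
  have "wp p (Pop stackv (saved P)) (wp p (Select 3 0 (map Resume P) Skip) Q) ?s"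
  proof (rule wp_mono[OF wp_Pop[where f = s and x = S]])
    fix t assume t: "t stackv = S \<and> (\<forall>v \<in> set (saved P). t v = s v)
      \<and> (\<forall>v. fst v \<notin> {1, 2} \<and> v \<notin> insert stackv (set (saved P)) \<longrightarrow> t v = ?s v)"
    have pc: "t (pcv 3) = pc"
      using t fr \<open>pc < length P\<close> by (simp add: saved_def frame_def holds_def)
    have X: "t argv = x" using t by (auto simp: saved_def)
    have R: "t (rg 3 j) = R j" if "j < width P" for j
      using t that fr by (auto simp: saved_def frame_def holds_def)
    let ?t = "t(tmpv 3 := pc, rg 3 i := x, pcv 3 := Suc pc)"
    have "agree_off {1, 2, 3, 6} s' t"
      unfolding agree_off_def using t by (auto simp: saved_def)
    then have "agree_off {1, 2, 3, 6} s0 t"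
      using fr' by (auto simp: frame_def agree_off_def)
    then have "agree_off {1, 2, 3, 6} s0 ?t"
      by (auto simp: agree_off_def)
    moreover have "holds 3 P (Suc pc, R(i := x)) ?t"
      using t fr' R iw \<open>pc < length P\<close> by (auto simp: holds_def frame_def saved_def)
    ultimately have Qt: "Q ?t"
      using t fr fr' by (intro Q) (auto simp: frame_def saved_def)
    show "wp p (Select 3 0 (map Resume P) Skip) Q t"
      by (rule wp_Select) (use Qt pc X \<open>pc < length P\<close> in \<open>auto simp: assms(3)\<close>)
  qed (use fr' in \<open>auto simp: saved_def frame_def\<close>)
  then show ?thesis by (simp add: Return_def x)
qed

text \<open>
  A run at depth \<open>d\<close> uses oracle \<open>q l\<close> with \<open>l = n - d\<close>. The same loop executes this run, the
  deeper ones and what follows, so a run is described by its effect on the rest of the evaluation: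
  the loop is correct from the start of the run if it is correct from its end on. In this form the statement can be applied
  to the deeper runs that occur inside, by induction on \<open>l\<close>; an inner induction follows the steps of
  the run itself.
\<close>

lemma wp_nested_run:
  assumes q0: "q 0 = p" and q: "\<And>i k. i < s0 indexv \<Longrightarrow> machine_outputs P (q i) [k] (q (Suc i) k)"
    and "frame s0 P d S (0, initial_regs [x]) s" and "d + l = s0 indexv" and "0 < d"
    and "\<And>t c. length P \<le> fst c \<Longrightarrow> snd c 0 = q (Suc l) x \<Longrightarrow> frame s0 P d S c t
      \<Longrightarrow> wp p (Loop stopv onev (Nested_Body P)) Q t"
  shows "wp p (Loop stopv onev (Nested_Body P)) Q s"
  using assms(3-)
proof (induction l arbitrary: d S x s rule: less_induct)
  case (less l)
  let ?loop = "Loop stopv onev (Nested_Body P)"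
  have run: "wp p ?loop Q u"
    if "(machine_step P (q l) ^^ n) c = (pc', R')" "length P \<le> pc'" "R' 0 = q (Suc l) x"
      "frame s0 P d S c u" for n c u pc' R'
    using that
  proof (induction n arbitrary: c u)
    case 0
    then show ?case using less.prems(4)[of "(pc', R')" u] by simp
  next
    case (Suc n)
    obtain pc R where c: "c = (pc, R)" by fastforce
    show ?case
    proof (cases "pc < length P")
      case False
      then have "machine_step P (q l) c = c" by (simp add: machine_step_def c)
      then show ?thesis using Suc by (simp add: funpow_swap1)
    next
      case True
      let ?c' = "exec_instr (q l) (P ! pc) (pc, R)"
      have "machine_step P (q l) c = ?c'" using True by (simp add: machine_step_def c)
      then have c': "(machine_step P (q l) ^^ n) ?c' = (pc', R')"
        using Suc.prems(1) by (simp add: funpow_swap1)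
      have next_state: "wp p ?loop Q t" if "frame s0 P d S ?c' t" for t
        using Suc.IH[OF c' Suc.prems(2,3) that] .
      have pcv: "u (pcv 3) = pc" using Suc.prems(4) True by (auto simp: frame_def holds_def c)
      let ?u = "u(tmpv 3 := pc)"
      have fr: "frame s0 P d S (pc, R) ?u"
        using Suc.prems(4) by (auto simp: frame_def agree_off_def c)
      have "wp p (Instr 3 (length P) (Nested_Ask P) (P ! pc)) (wp p ?loop Q) ?u"
      proof (cases "\<exists>i. P ! pc = Query i")
        case False
        have "holds 3 P (pc, R) ?u" using fr by (simp add: frame_def)
        moreover have "P ! pc \<noteq> Query i" for i using False by blast
        ultimately show ?thesis
        proof (rule wp_mono[OF wp_Instr[where q = "q l"], OF _ True])
          fix t assume "holds 3 P ?c' t \<and> agree_off {3} ?u t"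
          then show "wp p ?loop Q t"
            using fr by (intro next_state) (auto simp: frame_def agree_off_def)
        qed
      next
        case True
        then obtain i where i: "P ! pc = Query i" by blast
        have iw: "i < width P"
          using register_less_width[OF nth_mem[OF \<open>pc < length P\<close>], of i] by (simp add: i)
        have Ri: "u (rg 3 i) = R i" using iw fr by (simp add: frame_def holds_def)
        have "wp p (Nested_Ask P i) (wp p ?loop Q) ?u"
        proof (cases l)
          case 0
          have "u indexv = s0 indexv" using fr agree_offD[of _ s0 ?u indexv] by (auto simp: frame_def)
          then have "u indexv = u depthv" using 0 less.prems(2) fr by (simp add: frame_def)
          moreover have "frame s0 P d S ?c' (?u(rg 3 i := p (u (rg 3 i)), pcv 3 := Suc pc))"
            using fr iw \<open>pc < length P\<close> 0 q0 Ri
            by (auto simp: frame_def i holds_def agree_off_def)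
          ultimately show ?thesis
            using next_state pcv by (simp add: Nested_Ask_def)
        next
          case (Suc l')
          show ?thesis
          proof (rule frame_nested_ask[OF fr \<open>pc < length P\<close> i])
            fix t
            assume fr1: "frame s0 P (Suc d) (stack ?u (saved P) S) (0, initial_regs [R i]) t"
            show "wp p ?loop Q t"
            proof (rule less.IH[OF _ fr1])
              fix t c
              assume c: "length P \<le> fst c" "snd c 0 = q (Suc l') (R i)"
                and fr2: "frame s0 P (Suc d) (stack ?u (saved P) S) c t"
              have "t (rg 3 0) = q l (R i)"
                using fr2 c by (simp add: frame_def holds_def Suc)
              then have "wp p (Return P) (wp p ?loop Q) (t(tmpv 3 := y))" for y
                by (intro frame_return[OF fr \<open>pc < length P\<close> i, where c = c and x = "q l (R i)"]
                    next_state)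
                  (use fr2 in \<open>auto simp: frame_def agree_off_def i\<close>)
              then have "wp p (Nested_Body P) (wp p ?loop Q) t"
                unfolding Nested_Body_def using fr2 c(1) less.prems(3)
                by (intro wp_Select) (auto simp: frame_def holds_def)
              then show "wp p ?loop Q t"
                using fr2 by (subst wp_Loop) (simp add: frame_def)
            qed (use Suc less.prems(2) in auto)
          qed (use Suc less.prems(2) in auto)
        qed
        then show ?thesis by (simp add: i)
      qed
      then have "wp p (Nested_Body P) (wp p ?loop Q) u"
        unfolding Nested_Body_def using True by (intro wp_Select) (auto simp: pcv)
      then show ?thesis
        using Suc.prems(4) by (subst wp_Loop) (simp add: frame_def)
    qed
  qed
  have "machine_outputs P (q l) [x] (q (Suc l) x)"
    using q[of l x] less.prems(2,3) by simp
  then show ?case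
    unfolding machine_outputs_def using run less.prems(1) by blast
qed

text \<open>
  For a positive index the evaluation is one run at depth 1, whose end is recognised by the depth
  and makes the loop stop.
\<close>

lemma wp_Eval_Iterate:
  assumes q0: "q 0 = p" and q: "\<And>i k. i < s indexv \<Longrightarrow> machine_outputs P (q i) [k] (q (Suc i) k)"
    and "s nilv = 0"
  shows "wp p (Eval_Iterate P)
    (\<lambda>t. \<exists>u. t = u(argv := q (s indexv) (s argv)) \<and> agree_off {1, 2, 3, 6} s u) s"
proof (cases "s indexv")
  case 0
  then show ?thesis
    using assms by (auto simp: Eval_Iterate_def agree_off_def)
next
  case (Suc n)
  let ?Q = "\<lambda>t. \<exists>u. t = u(argv := q (s indexv) (s argv)) \<and> agree_off {1, 2, 3, 6} s u"
  let ?s = "s(onev := Suc 0, depthv := Suc 0, stopv := 0, lenv 3 := length P)"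
  let ?u = "(\<lambda>v. if v \<in> set (map (rg 3) [0..<width P]) then 0 else (?s(pcv 3 := 0)) v)(rg 3 0 := s argv)"
  have "wp p (Loop stopv onev (Nested_Body P)) (wp p (Assign argv (rg 3 0)) ?Q) ?u"
  proof (rule wp_nested_run[OF q0 q])
    have "holds 3 P (0, initial_regs [s argv]) ?u"
      by (rule holds_New_Frame) auto
    moreover have "agree_off {1, 2, 3, 6} s ?u"
      by (auto simp: agree_off_def)
    ultimately show "frame s P 1 (s stackv) (0, initial_regs [s argv]) ?u"
      by (simp add: frame_def)
    fix t c assume "length P \<le> fst c" "snd c 0 = q (Suc n) (s argv)" "frame s P 1 (s stackv) c t"
    then have fr: "frame s P 1 (s stackv) c t" and c: "length P \<le> fst c"
      and out: "t (rg 3 0) = q (s indexv) (s argv)"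
      by (auto simp: frame_def holds_def Suc)
    let ?W = "wp p (Loop stopv onev (Nested_Body P)) (wp p (Assign argv (rg 3 0)) ?Q)"
    have "wp p (Cond depthv onev (Inc stopv) (Return P)) ?W (t(tmpv 3 := y))" for y
    proof -
      let ?v = "t(tmpv 3 := y, stopv := 1)"
      have "agree_off {1, 2, 3, 6} s ?v" using fr by (auto simp: frame_def agree_off_def)
      then have "wp p (Assign argv (rg 3 0)) ?Q ?v" using out by auto
      moreover have "?v stopv = ?v onev" using fr by (simp add: frame_def)
      ultimately have "?W ?v" by (subst wp_Loop) (simp only: simp_thms if_True)
      then show ?thesis using fr by (simp add: frame_def)
    qed
    then have "wp p (Nested_Body P) ?W t"
      unfolding Nested_Body_def using fr c
      by (intro wp_Select) (auto simp: frame_def holds_def simp del: wp_simps)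
    then show "wp p (Loop stopv onev (Nested_Body P)) (wp p (Assign argv (rg 3 0)) ?Q) t"
      using fr by (subst wp_Loop) (simp add: frame_def)
  qed (use Suc in auto)
  then show ?thesis
    using assms Suc by (simp add: Eval_Iterate_def New_Frame_def)
qed

end

section \<open>Computable operators on Baire space\<close>

text \<open>
  Rules as equations between predicate transformers, for occurrences in a postcondition, where the
  store argument is missing.
\<close>

lemma wp_Assign: "wp p (Assign v w) Q = (\<lambda>s. Q (s(v := s w)))"
  by auto

lemma wp_Seq: "wp p (c ;; d) Q = wp p c (wp p d Q)"
  by auto

definition Apply :: "nat \<Rightarrow> instr list \<Rightarrow> var \<Rightarrow> com" where
  "Apply b P v = Assign (rg b 0) v ;; Call b P 1 (\<lambda>i. Ask (rg b i)) ;; Assign v (rg b 0)"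

lemma wp_Apply:
  assumes "machine_outputs P p [s v] x" "fst v \<noteq> b"
  shows "wp p (Apply b P v) (\<lambda>t. \<exists>u. t = u(v := x) \<and> agree_off {b} s u) s"
proof -
  let ?s = "s(rg b 0 := s v)"
  have "wp p (Call b P (length [s v]) (\<lambda>i. Ask (rg b i)))
    (\<lambda>t. t (rg b 0) = x \<and> agree_off {b} ?s t) ?s"
    by (rule wp_Call_oracle[OF assms(1)]) auto
  then have "wp p (Call b P 1 (\<lambda>i. Ask (rg b i)))
    (\<lambda>t. t (rg b 0) = x \<and> agree_off {b} ?s t) ?s" by simp
  then show ?thesis
    unfolding Apply_def using assms(2)
    by (auto elim!: wp_mono simp: agree_off_def intro!: exI)
qed

lemma computable_const: "computable_baire (\<lambda>p. Some (\<lambda>k. n))"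
  by (rule computable_baireI[where c = "Const (0, 0) n"]) auto

text \<open>
  Composition is the case of a simulated oracle whose entries come from a second machine, which
  has the true oracle.
\<close>

lemma computable_comp:
  assumes "computable_baire \<gamma>" "computable_baire \<delta>"
  shows "computable_baire (\<lambda>p. Option.bind (\<delta> p) \<gamma>)"
proof -
  obtain P where P: "\<And>p q k. \<gamma> p = Some q \<Longrightarrow> machine_outputs P p [k] (q k)"
    using assms(1) unfolding computable_baire_def by blast
  obtain P' where P': "\<And>p q k. \<delta> p = Some q \<Longrightarrow> machine_outputs P' p [k] (q k)"
    using assms(2) unfolding computable_baire_def by blast
  let ?call = "Call 4 P 1 (\<lambda>i. Apply 5 P' (rg 4 i))"
  let ?c = "Assign (rg 4 0) (0, 0) ;; ?call ;; Assign (0, 0) (rg 4 0)"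
  show ?thesis
  proof (rule computable_baireI[where c = ?c])
    fix p r k assume "Option.bind (\<delta> p) \<gamma> = Some r"
    then obtain q where q: "\<delta> p = Some q" "\<gamma> q = Some r" by (auto simp: Option.bind_eq_Some_conv)
    let ?s = "(input_store k)(rg 4 0 := k)"
    have "wp p (Call 4 P (length [k]) (\<lambda>i. Apply 5 P' (rg 4 i)))
      (\<lambda>t. t (rg 4 0) = r k \<and> agree_off (insert 4 {5}) ?s t) ?s"
      by (rule wp_Call[OF P[OF q(2)]]) (auto intro!: wp_Apply P' q(1))
    then have "wp p ?call (\<lambda>t. t (rg 4 0) = r k) ?s"
      by (auto elim: wp_mono)
    then show "wp p ?c (\<lambda>t. t (0, 0) = r k) (input_store k)"
      by (simp add: input_store_def wp_Assign)
  qed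
qed

text \<open>
  On names, \<open>\<gamma>\<close> is iterated as long as the result of \<open>\<delta>\<close> begins with an odd number.
\<close>

inductive iterates :: "(baire \<rightharpoonup> baire) \<Rightarrow> (baire \<rightharpoonup> baire) \<Rightarrow> baire \<Rightarrow> baire \<Rightarrow> bool"
  for \<gamma> \<delta> where
  stop: "\<delta> p = Some c \<Longrightarrow> even (c 0) \<Longrightarrow> iterates \<gamma> \<delta> p p"
| go: "\<delta> p = Some c \<Longrightarrow> odd (c 0) \<Longrightarrow> \<gamma> p = Some q \<Longrightarrow> iterates \<gamma> \<delta> q r \<Longrightarrow> iterates \<gamma> \<delta> p r"

text \<open>
  The computation refers to the intermediate points by their index, so the derivation is unrolled
  into a sequence.
\<close>

lemma iterates_sequence:
  assumes "iterates \<gamma> \<delta> p r"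
  shows "\<exists>n q. q 0 = p \<and> q n = r \<and> (\<exists>c. \<delta> (q n) = Some c \<and> even (c 0))
    \<and> (\<forall>i<n. \<gamma> (q i) = Some (q (Suc i)) \<and> (\<exists>c. \<delta> (q i) = Some c \<and> odd (c 0)))"
  using assms
proof induction
  case (stop p c)
  then show ?case by (intro exI[of _ 0] exI[of _ "\<lambda>_. p"]) auto
next
  case (go p c p' r)
  then obtain n q where q: "q 0 = p'" "q n = r" "\<exists>c. \<delta> (q n) = Some c \<and> even (c 0)"
    "\<forall>i<n. \<gamma> (q i) = Some (q (Suc i)) \<and> (\<exists>c. \<delta> (q i) = Some c \<and> odd (c 0))" by blast
  show ?case
    by (intro exI[of _ "Suc n"] exI[of _ "case_nat p q"])
      (use q go.hyps in \<open>auto split: nat.split\<close>)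
qed

text \<open>
  The choice is harmless, since the process is deterministic.
\<close>

definition iterate :: "(baire \<rightharpoonup> baire) \<Rightarrow> (baire \<rightharpoonup> baire) \<Rightarrow> (baire \<rightharpoonup> baire)" where
  "iterate \<gamma> \<delta> p = (if \<exists>r. iterates \<gamma> \<delta> p r then Some (SOME r. iterates \<gamma> \<delta> p r) else None)"

lemma iterate_SomeD: "iterate \<gamma> \<delta> p = Some r \<Longrightarrow> iterates \<gamma> \<delta> p r"
  unfolding iterate_def by (auto split: if_splits intro: someI[of "iterates \<gamma> \<delta> p"])

context computable_pairing
begin

lemma computable_pair:
  assumes "computable_baire \<gamma>" "computable_baire \<delta>"
  shows "computable_baire (\<lambda>p. case (\<gamma> p, \<delta> p) of
     (Some q, Some r) \<Rightarrow> Some (\<lambda>k. E (q k) (r k)) | _ \<Rightarrow> None)"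
proof -
  obtain P where P: "\<And>p q k. \<gamma> p = Some q \<Longrightarrow> machine_outputs P p [k] (q k)"
    using assms(1) unfolding computable_baire_def by blast
  obtain P' where P': "\<And>p q k. \<delta> p = Some q \<Longrightarrow> machine_outputs P' p [k] (q k)"
    using assms(2) unfolding computable_baire_def by blast
  let ?c = "Assign (0, 1) (0, 0) ;; Apply 4 P (0, 0) ;; Apply 4 P' (0, 1) ;;
    Assign leftv (0, 0) ;; Assign rightv (0, 1) ;; Enc ;; Assign (0, 0) codev"
  show ?thesis
  proof (rule computable_baireI[where c = ?c])
    fix p y k
    assume "(case (\<gamma> p, \<delta> p) of
     (Some q, Some r) \<Rightarrow> Some (\<lambda>k. E (q k) (r k)) | _ \<Rightarrow> None) = Some y"
    then obtain q r where q: "\<gamma> p = Some q" and r: "\<delta> p = Some r" and y: "y = (\<lambda>k. E (q k) (r k))"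
      by (auto split: option.splits)
    let ?s = "(input_store k)((0, 1) := k)"
    let ?Q = "\<lambda>t. t (0, 0) = y k"
    let ?c3 = "Assign leftv (0, 0) ;; Assign rightv (0, 1) ;; Enc ;; Assign (0, 0) codev"
    have c3: "wp p ?c3 ?Q t" if "t (0, 0) = q k" "t (0, 1) = r k" for t
    proof -
      have "wp p Enc (\<lambda>t. t codev = E (q k) (r k)) (t(leftv := q k, rightv := r k))"
        by (rule wp_mono[OF wp_Enc]) simp
      then show ?thesis using that by (simp add: y wp_Assign)
    qed
    have "wp p (Apply 4 P (0, 0)) (wp p (Apply 4 P' (0, 1)) (wp p ?c3 ?Q)) ?s"
    proof (rule wp_mono[OF wp_Apply[where x = "q k"]])
      fix t assume "\<exists>u. t = u((0, 0) := q k) \<and> agree_off {4} ?s u"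
      then have t: "t (0, 0) = q k" "t (0, 1) = k"
        by (auto simp: agree_off_def)
      show "wp p (Apply 4 P' (0, 1)) (wp p ?c3 ?Q) t"
      proof (rule wp_mono[OF wp_Apply[where x = "r k"]])
        fix t' assume "\<exists>u. t' = u((0, 1) := r k) \<and> agree_off {4} t u"
        then show "wp p ?c3 ?Q t'" using t by (intro c3) (auto simp: agree_off_def)
      qed (use P'[OF r] t in auto)
    qed (use P[OF q, of k] in \<open>auto simp: input_store_def\<close>)
    then show "wp p ?c ?Q (input_store k)"
      by (simp add: input_store_def wp_Seq)
  qed
qed

lemma wp_component:
  assumes "v = leftv \<or> v = rightv"
    and "s wholev = p k" "p k = E a b"
  shows "wp p (Dec ;; Assign (0, 0) v) (\<lambda>t. t (0, 0) = (if v = leftv then a else b)) s"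
proof -
  have "wp p Dec (\<lambda>t. t leftv = a \<and> t rightv = b) s"
    by (rule wp_mono[OF wp_Dec[where a = a and b = b]]) (use assms in auto)
  then show ?thesis using assms(1) by (auto elim!: wp_mono)
qed

text \<open>
  Turns a name of \<open>z\<close> into one of \<open>L\<^sub>1(z)\<close> or \<open>R\<^sub>1(z)\<close>: for pairs (odd first entry) it selects a
  component in each entry; the zero sequence, which names the object \<open>o\<close>, stays as it is; and the
  names of elements of \<open>X\<close> (positive even entries) become the name of \<open>(o, o)\<close>.
\<close>

definition component :: "(nat \<times> nat \<Rightarrow> nat) \<Rightarrow> baire \<Rightarrow> baire" where
  "component f p k = (if odd (p 0) then f (SOME x. p k = E (fst x) (snd x))
     else if p 0 = 0 then 0 else E 0 0)"

lemma component_pair: "component f (\<lambda>k. E (q k) (r k)) k = f (q k, r k)"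
proof -
  have "(SOME x. E (q k) (r k) = E (fst x) (snd x)) = (q k, r k)"
    by (rule some_equality) (auto simp: prod_eq_iff)
  then show ?thesis by (simp add: component_def) (simp add: E_def)
qed

text \<open>
  The domain is restricted to sequences of the form that names have, because on other sequences
  with an odd first entry the search for the components of an entry may go on forever.
\<close>

lemma computable_component:
  assumes "f = fst \<and> v = leftv \<or> f = snd \<and> v = rightv"
  shows "computable_baire (\<lambda>p. if odd (p 0) \<longrightarrow> (\<exists>q r. p = (\<lambda>k. E (q k) (r k)))
     then Some (component f p) else None)"
proof -
  let ?pair = "Assign wholev (0, 0) ;; Ask wholev ;; Dec ;; Assign (0, 0) v"
  let ?nonpair = "Zero leftv ;; Cond wholev leftv (Zero (0, 0)) (Const (0, 0) (E 0 0))"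
  let ?c = "Zero wholev ;; Ask wholev ;; Parity ;; Zero leftv ;; Cond codev leftv ?nonpair ?pair"
  show ?thesis
  proof (rule computable_baireI[where c = ?c])
    fix p y k assume "(if odd (p 0) \<longrightarrow> (\<exists>q r. p = (\<lambda>k. E (q k) (r k)))
     then Some (component f p) else None) = Some y"
    then have pr: "odd (p 0) \<Longrightarrow> \<exists>q r. p = (\<lambda>k. E (q k) (r k))" and y: "y = component f p"
      by (auto split: if_splits)
    let ?Q = "\<lambda>t. t (0, 0) = y k"
    let ?s = "(input_store k)(wholev := p 0)"
    have "wp p Parity (wp p (Zero leftv ;; Cond codev leftv ?nonpair ?pair) ?Q) ?s"
    proof (rule wp_mono[OF wp_Parity])
      fix t assume t: "t codev = ?s wholev mod 2 \<and> t wholev = ?s wholev \<and> agree_off {2} ?s t"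
      have k: "t (0, 0) = k" using t by (auto simp: agree_off_def input_store_def)
      show "wp p (Zero leftv ;; Cond codev leftv ?nonpair ?pair) ?Q t"
      proof (cases "odd (p 0)")
        case False
        then show ?thesis using t by (auto simp: y component_def)
      next
        case True
        then obtain q r where p: "p = (\<lambda>k. E (q k) (r k))" using pr by blast
        have "wp p (Dec ;; Assign (0, 0) v) ?Q (t(leftv := 0, wholev := p k))"
          by (rule wp_mono[OF wp_component[where a = "q k" and b = "r k" and v = v and p = p and k = k]])
            (use assms in \<open>auto simp: p y component_pair\<close>)
        moreover have "t codev = 1" using t True by (simp add: odd_iff_mod_2_eq_one)
        ultimately show ?thesis by (simp add: k)
      qed
    qed
    then show "wp p ?c ?Q (input_store k)" by (simp add: input_store_def)
  qed
qed

text \<open>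
  The control of the iteration: the result 1 calls for another application of the first machine.
\<close>

definition Eval_Test :: "instr list \<Rightarrow> instr list \<Rightarrow> com" where
  "Eval_Test P P' = Zero (rg 4 0) ;;
     Call 4 P' 1 (\<lambda>i. Assign argv (rg 4 i) ;; Eval_Iterate P ;; Assign (rg 4 i) argv) ;;
     Assign wholev (rg 4 0) ;; Parity"

lemma wp_Eval_Test:
  assumes q: "q 0 = p" "\<And>i k. i < s indexv \<Longrightarrow> machine_outputs P (q i) [k] (q (Suc i) k)"
    and "s nilv = 0" and x: "machine_outputs P' (q (s indexv)) [0] x"
  shows "wp p (Eval_Test P P') (\<lambda>t. t codev = x mod 2 \<and> agree_off {1, 2, 3, 4, 6} s t) s"
proof -
  let ?call = "Call 4 P' 1 (\<lambda>i. Assign argv (rg 4 i) ;; Eval_Iterate P ;; Assign (rg 4 i) argv)"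
  let ?s = "s(rg 4 0 := 0)"
  let ?Q = "\<lambda>t. t codev = x mod 2 \<and> agree_off {1, 2, 3, 4, 6} s t"
  have "wp p (Call 4 P' (length [0 :: nat])
        (\<lambda>i. Assign argv (rg 4 i) ;; Eval_Iterate P ;; Assign (rg 4 i) argv))
      (\<lambda>t. t (rg 4 0) = x \<and> agree_off (insert 4 {1, 2, 3, 6}) ?s t) ?s"
  proof (rule wp_Call[OF x])
    fix u i assume "agree_off (insert 4 {1, 2, 3, 6}) ?s u"
    then have indexv: "u indexv = s indexv" "u nilv = 0"
      using \<open>s nilv = 0\<close> by (auto simp: agree_off_def)
    let ?u = "u(argv := u (rg 4 i))"
    have "wp p (Eval_Iterate P)
        (\<lambda>t. \<exists>v. t = v(argv := q (?u indexv) (?u argv)) \<and> agree_off {1, 2, 3, 6} ?u v) ?u"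
      by (rule wp_Eval_Iterate[where q = q, OF q(1)]) (use indexv q(2) in auto)
    then have "wp p (Eval_Iterate P) (\<lambda>t. \<exists>v. t = v(argv := q (s indexv) (u (rg 4 i)))
        \<and> agree_off {1, 2, 3, 6} u v) ?u"
      by (rule wp_mono) (auto simp: indexv agree_off_def)
    then have "wp p (Eval_Iterate P) (wp p (Assign (rg 4 i) argv)
       (\<lambda>t. \<exists>v. t = v(rg 4 i := q (s indexv) (u (rg 4 i))) \<and> agree_off {1, 2, 3, 6} u v)) ?u"
    proof (rule wp_mono)
      fix t assume "\<exists>v. t = v(argv := q (s indexv) (u (rg 4 i))) \<and> agree_off {1, 2, 3, 6} u v"
      then have "t argv = q (s indexv) (u (rg 4 i))" "agree_off {1, 2, 3, 6} u t"
        by (auto simp: agree_off_def)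
      then show "wp p (Assign (rg 4 i) argv)
         (\<lambda>t. \<exists>v. t = v(rg 4 i := q (s indexv) (u (rg 4 i))) \<and> agree_off {1, 2, 3, 6} u v) t"
        by auto
    qed
    then show "wp p (Assign argv (rg 4 i) ;; Eval_Iterate P ;; Assign (rg 4 i) argv)
       (\<lambda>t. \<exists>v. t = v(rg 4 i := q (s indexv) (u (rg 4 i))) \<and> agree_off {1, 2, 3, 6} u v) u"
      by simp
  qed auto
  then have "wp p ?call (\<lambda>t. t (rg 4 0) = x \<and> agree_off (insert 4 {1, 2, 3, 6}) ?s t) ?s"
    by simp
  then have "wp p ?call (wp p (Assign wholev (rg 4 0) ;; Parity) ?Q) ?s"
  proof (rule wp_mono)
    fix t assume t: "t (rg 4 0) = x \<and> agree_off (insert 4 {1, 2, 3, 6}) ?s t"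
    have "wp p Parity ?Q (t(wholev := x))"
      by (rule wp_mono[OF wp_Parity]) (use t in \<open>auto simp: agree_off_def\<close>)
    then show "wp p (Assign wholev (rg 4 0) ;; Parity) ?Q t" using t by simp
  qed
  then show ?thesis by (simp add: Eval_Test_def)
qed

text \<open>
  Search for the least index at which the test comes out even, and then evaluate the iterate with
  this index at the input.
\<close>

lemma computable_iterate:
  assumes "computable_baire \<gamma>" "computable_baire \<delta>"
  shows "computable_baire (iterate \<gamma> \<delta>)"
proof -
  obtain P where P: "\<And>p q k. \<gamma> p = Some q \<Longrightarrow> machine_outputs P p [k] (q k)"
    using assms(1) unfolding computable_baire_def by blast
  obtain P' where P': "\<And>p q k. \<delta> p = Some q \<Longrightarrow> machine_outputs P' p [k] (q k)"
    using assms(2) unfolding computable_baire_def by blast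
  let ?loop = "Loop codev nilv (Inc indexv ;; Eval_Test P P')"
  let ?out = "Assign argv (0, 0) ;; Eval_Iterate P ;; Assign (0, 0) argv"
  show ?thesis
  proof (rule computable_baireI[where c = "Eval_Test P P' ;; ?loop ;; ?out"])
    fix p r k assume "iterate \<gamma> \<delta> p = Some r"
    from iterates_sequence[OF iterate_SomeD[OF this]]
    obtain n q where nq: "q 0 = p \<and> q n = r \<and> (\<exists>c. \<delta> (q n) = Some c \<and> even (c 0))
      \<and> (\<forall>i<n. \<gamma> (q i) = Some (q (Suc i)) \<and> (\<exists>c. \<delta> (q i) = Some c \<and> odd (c 0)))"
      by (elim exE) (rule that)
    then have q0: "q 0 = p" and qn: "q n = r" and even: "\<exists>c. \<delta> (q n) = Some c \<and> even (c 0)"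
      by blast+
    have run: "\<gamma> (q i) = Some (q (Suc i)) \<and> (\<exists>c. \<delta> (q i) = Some c \<and> odd (c 0))" if "i < n" for i
      using nq that by simp
    have q: "machine_outputs P (q i) [k] (q (Suc i) k)" if "i < n" for i k
      using P run[OF that] by simp
    let ?Q = "\<lambda>t. t (0, 0) = r k"
    \<comment> \<open>Up to index \<open>n\<close> all iterates exist, which is needed for the tests to terminate.\<close>
    have test: "wp p (Eval_Test P P')
        (\<lambda>t. t codev = (if s indexv = n then 0 else 1) \<and> agree_off {1, 2, 3, 4, 6} s t) s"
      if le: "s indexv \<le> n" and "s nilv = 0" for s
    proof -
      obtain c where c: "\<delta> (q (s indexv)) = Some c" "c 0 mod 2 = (if s indexv = n then 0 else 1)"
        using le even run[of "s indexv"] by (cases "s indexv = n") (auto simp: odd_iff_mod_2_eq_one)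
      show ?thesis
        unfolding c(2)[symmetric]
        by (rule wp_Eval_Test[where q = q, OF q0]) (use le that q P'[OF c(1)] in auto)
    qed
    have out: "wp p ?out ?Q s" if "s indexv = n" "s nilv = 0" "s (0, 0) = k" for s
    proof -
      let ?s = "s(argv := k)"
      have "wp p (Eval_Iterate P)
          (\<lambda>t. \<exists>u. t = u(argv := q (?s indexv) (?s argv)) \<and> agree_off {1, 2, 3, 6} ?s u) ?s"
        by (rule wp_Eval_Iterate[where q = q, OF q0]) (use that q in auto)
      then have "wp p (Eval_Iterate P) (wp p (Assign (0, 0) argv) ?Q) ?s"
        by (rule wp_mono) (use that qn in auto)
      then show ?thesis using that by simp
    qed
    have loop: "wp p ?loop (wp p ?out ?Q) s"
      if "s indexv \<le> n" "s nilv = 0" "s (0, 0) = k" "s codev = (if s indexv = n then 0 else 1)" for s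
      using that
    proof (induction "n - s indexv" arbitrary: s)
      case 0
      then show ?case using out[of s] by (subst wp_Loop) simp
    next
      case (Suc m)
      let ?s = "s(indexv := Suc (s indexv))"
      have "wp p (Eval_Test P P') (wp p ?loop (wp p ?out ?Q)) ?s"
      proof (rule wp_mono[OF test])
        fix t assume t: "t codev = (if ?s indexv = n then 0 else 1) \<and> agree_off {1, 2, 3, 4, 6} ?s t"
        then have "t indexv = Suc (s indexv)" "t nilv = s nilv" "t (0, 0) = s (0, 0)"
          by (auto simp: agree_off_def)
        then show "wp p ?loop (wp p ?out ?Q) t"
          using Suc.hyps(2) Suc.prems t by (intro Suc.hyps(1)) auto
      qed (use Suc in auto)
      then show ?case
        using Suc.hyps(2) Suc.prems by (subst wp_Loop) auto
    qed
    have "wp p (Eval_Test P P') (wp p ?loop (wp p ?out ?Q)) (input_store k)"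
    proof (rule wp_mono[OF test])
      fix t assume t: "t codev = (if input_store k indexv = n then 0 else 1)
        \<and> agree_off {1, 2, 3, 4, 6} (input_store k) t"
      then have "t indexv = 0" "t nilv = 0" "t (0, 0) = k"
        by (auto simp: agree_off_def input_store_def)
      then show "wp p ?loop (wp p ?out ?Q) t"
        using t by (intro loop) (auto simp: input_store_def)
    qed (auto simp: input_store_def)
    then show "wp p (Eval_Test P P' ;; ?loop ;; ?out) ?Q (input_store k)" by (simp add: wp_Seq)
  qed
qed

end

section \<open>Paths and iteration domains\<close>

lemma calF2I:
  assumes "\<And>z. z \<in> dom \<phi> \<Longrightarrow> z \<in> mosch_ext X"
    and "\<And>z Y. \<phi> z = Some Y \<Longrightarrow> Y \<noteq> {}"
    and "\<And>z Y y. \<phi> z = Some Y \<Longrightarrow> y \<in> Y \<Longrightarrow> y \<in> mosch_ext X"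
  shows "\<phi> \<in> calF2 X"
  using assms unfolding calF2_def by (fastforce simp: ran_def)

lemma calF2D:
  assumes "\<phi> \<in> calF2 X" "\<phi> z = Some Y"
  shows "z \<in> mosch_ext X" "Y \<subseteq> mosch_ext X"
  using assms unfolding calF2_def by (auto simp: ran_def dom_def)

lemma Pair_mem_mosch_ext [simp]:
  "Pair x y \<in> mosch_ext X \<longleftrightarrow> x \<in> mosch_ext X \<and> y \<in> mosch_ext X"
  by (auto elim: mosch_ext.cases intro: mosch_ext.pair simp: basic_def)

lemma Obj_mem_mosch_ext [simp]: "Obj \<in> mosch_ext X"
  by (auto intro: mosch_ext.basic simp: basic_def)

lemma L1_mem_mosch_ext: "z \<in> mosch_ext X \<Longrightarrow> L1 z \<in> mosch_ext X"
  by (cases z) auto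

lemma R1_mem_mosch_ext: "z \<in> mosch_ext X \<Longrightarrow> R1 z \<in> mosch_ext X"
  by (cases z) auto

text \<open>
  Together with the parity criterion below: the value of a name is a basic object if and only if
  its first entry is even.
\<close>

lemma mem_basic_iff:
  assumes "z \<in> mosch_ext X"
  shows "z \<in> basic X \<longleftrightarrow> \<not> (\<exists>x y. z = Pair x y)"
  using assms by cases (auto simp: basic_def)

lemma star_name_pair_iff_odd:
  assumes "star_name J \<rho> q z"
  shows "(\<exists>x y. z = Pair x y) \<longleftrightarrow> odd (q 0)"
  using assms by cases auto

text \<open>
  Paths from a successor of \<open>z\<close> become paths from \<open>z\<close> when \<open>z\<close> is put in front, so they inherit
  both conditions on the domain.
\<close>

lemma iteration_dom_step:
  assumes z: "z \<in> iteration_dom X \<sigma> \<chi>" and step: "path_step X \<sigma> \<chi> z z'" and "z' \<in> mosch_ext X"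
  shows "z' \<in> iteration_dom X \<sigma> \<chi>"
proof -
  have zX: "z \<in> mosch_ext X" using z by (simp add: iteration_dom_def)
  have inf: "\<exists>g. infinite_path X \<sigma> \<chi> g \<and> g 0 = z \<and> range f \<subseteq> range g"
    if "infinite_path X \<sigma> \<chi> f" "f 0 = z'" for f
  proof (intro exI conjI)
    show "infinite_path X \<sigma> \<chi> (case_nat z f)"
      using that step zX by (auto simp: infinite_path_def image_subset_iff split: nat.split)
    show "range f \<subseteq> range (case_nat z f)"
      by (auto intro: range_eqI[where x = "Suc _"])
  qed simp
  moreover have "term_of_path_from X \<sigma> \<chi> z u" if "term_of_path_from X \<sigma> \<chi> z' u" for u
    using that unfolding term_of_path_from_def
  proof (elim disjE exE conjE)
    fix us assume us: "finite_path X \<sigma> \<chi> us" "hd us = z'" "u \<in> set us"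
    then have "finite_path X \<sigma> \<chi> (z # us)"
      using step zX by (cases us) (auto simp: finite_path_def)
    with us show "(\<exists>us. finite_path X \<sigma> \<chi> us \<and> hd us = z \<and> u \<in> set us)
       \<or> (\<exists>f. infinite_path X \<sigma> \<chi> f \<and> f 0 = z \<and> u \<in> range f)"
      by (metis list.sel(1) list.set_intros(2))
  next
    fix f assume "infinite_path X \<sigma> \<chi> f" "f 0 = z'" "u \<in> range f"
    with inf[of f] show "(\<exists>us. finite_path X \<sigma> \<chi> us \<and> hd us = z \<and> u \<in> set us)
       \<or> (\<exists>f. infinite_path X \<sigma> \<chi> f \<and> f 0 = z \<and> u \<in> range f)"
      by blast
  qed
  ultimately show ?thesis
    using z \<open>z' \<in> mosch_ext X\<close> unfolding iteration_dom_def by blast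
qed

text \<open>
  The point itself is a term of the path that consists of it alone.
\<close>

lemma iteration_domD:
  assumes "z \<in> iteration_dom X \<sigma> \<chi>"
  shows "z \<in> dom \<chi>" "the (\<chi> z) - basic X \<noteq> {} \<Longrightarrow> z \<in> dom \<sigma>"
proof -
  have "term_of_path_from X \<sigma> \<chi> z z"
    unfolding term_of_path_from_def finite_path_def
    using assms by (intro disjI1 exI[of _ "[z]"]) (auto simp: iteration_dom_def)
  then show "z \<in> dom \<chi>" "the (\<chi> z) - basic X \<noteq> {} \<Longrightarrow> z \<in> dom \<sigma>"
    using assms by (auto simp: iteration_dom_def)
qed

text \<open>
  Again a path is extended at its front.
\<close>

lemma iteration_step:
  assumes "z \<in> iteration_dom X \<sigma> \<chi>" "path_step X \<sigma> \<chi> z z'"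
    and "iteration X \<sigma> \<chi> z' = Some Y" "v \<in> Y"
  shows "\<exists>Y. iteration X \<sigma> \<chi> z = Some Y \<and> v \<in> Y"
proof -
  obtain us where us: "finite_path X \<sigma> \<chi> us" "hd us = z'" "last us = v"
    and v: "v \<in> dom \<chi>" "the (\<chi> v) \<inter> basic X \<noteq> {}"
    using assms(3,4) by (auto simp: iteration_def split: if_splits)
  have "finite_path X \<sigma> \<chi> (z # us)" "last (z # us) = v"
    using us assms(1,2) by (cases us; auto simp: finite_path_def iteration_dom_def)+
  then show ?thesis using v assms(1) unfolding iteration_def
    by (metis (mono_tags, lifting) list.sel(1) mem_Collect_eq)
qed

section \<open>Closure of the computable multi-valued functions\<close>

locale represented_extension = computable_pairing +
  fixes X :: "'a set" and \<rho> :: "baire \<rightharpoonup> 'a"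
  assumes rho: "representation \<rho> X"
begin

lemma star_rep [simp]: "star_rep J \<rho> p = Some z \<longleftrightarrow> star_name J \<rho> p z"
  by (rule star_rep_iff[OF inj_J])

lemma ex_name: "z \<in> mosch_ext X \<longleftrightarrow> (\<exists>p. star_name J \<rho> p z)"
  using representation_star_rep[OF inj_J rho] by (auto simp: representation_def ran_def)

lemma star_name_pair: "star_name J \<rho> q y \<Longrightarrow> star_name J \<rho> r z
    \<Longrightarrow> star_name J \<rho> (\<lambda>k. E (q k) (r k)) (Pair y z)"
  unfolding E_def by (rule star_name.pair)

text \<open>
  Values of a realized function are non-empty for free: each point of the extension has a name, and
  the realizer turns it into a name of an element of the value.
\<close>

lemma mem_calB2I:
  assumes "computable_baire \<gamma>" "dom \<phi> \<subseteq> mosch_ext X"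
    and "\<And>z Y. \<phi> z = Some Y \<Longrightarrow> Y \<subseteq> mosch_ext X"
    and real: "\<And>p z Y. star_name J \<rho> p z \<Longrightarrow> \<phi> z = Some Y \<Longrightarrow>
       \<exists>q y. \<gamma> p = Some q \<and> star_name J \<rho> q y \<and> y \<in> Y"
  shows "\<phi> \<in> calB2 X J \<rho>"
proof -
  have "Y \<noteq> {}" if Y: "\<phi> z = Some Y" for z Y
  proof -
    have "z \<in> mosch_ext X" using assms(2) Y by blast
    then obtain p where "star_name J \<rho> p z" using ex_name by blast
    then show ?thesis using real[OF _ Y] by blast
  qed
  then have "\<phi> \<in> calF2 X" using assms(2,3) by (intro calF2I) blast+
  then show ?thesis
    using assms(1) real
    unfolding calB2_def computable_multifun_def realization_def star_rep by blast
qed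

abbreviation realizes :: "(baire \<rightharpoonup> baire) \<Rightarrow> ('a mosch, 'a mosch) multifun \<Rightarrow> bool" where
  "realizes \<equiv> realization (star_rep J \<rho>) (star_rep J \<rho>)"

lemma calB2E:
  assumes "\<phi> \<in> calB2 X J \<rho>"
  obtains \<gamma> where "computable_baire \<gamma>" "\<phi> \<in> calF2 X" "realizes \<gamma> \<phi>"
  using assms unfolding calB2_def computable_multifun_def by blast

lemma realizesD:
  assumes "realizes \<gamma> \<phi>" "star_name J \<rho> p z" "\<phi> z = Some Y"
  shows "\<exists>q y. \<gamma> p = Some q \<and> star_name J \<rho> q y \<and> y \<in> Y"
  using assms unfolding realization_def star_rep by blast

lemma star_name_const_pair: "star_name J \<rho> (\<lambda>k. E 0 0) (Pair Obj Obj)"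
  using star_name_pair[OF star_name.obj star_name.obj] .

lemma star_name_component:
  assumes "star_name J \<rho> p z"
  shows "star_name J \<rho> (component fst p) (L1 z)" "star_name J \<rho> (component snd p) (R1 z)"
proof -
  have "star_name J \<rho> (component fst p) (L1 z) \<and> star_name J \<rho> (component snd p) (R1 z)"
    using assms
  proof cases
    case (atom q x)
    then have "component f p = (\<lambda>k. E 0 0)" for f by (auto simp: component_def)
    then show ?thesis using atom star_name_const_pair by simp
  next
    case obj
    then have "component f p = (\<lambda>k. 0)" for f by (auto simp: component_def)
    then show ?thesis using obj star_name.obj by simp
  next
    case (pair q y r w)
    then have "component f p = (\<lambda>k. f (q k, r k))" for f
      using component_pair[of f q r] by (auto simp: E_def)
    then show ?thesis using pair by simp
  qed
  then show "star_name J \<rho> (component fst p) (L1 z)" "star_name J \<rho> (component snd p) (R1 z)"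
    by auto
qed

lemma star_name_odd:
  assumes "star_name J \<rho> p z"
  shows "odd (p 0) \<longrightarrow> (\<exists>q r. p = (\<lambda>k. E (q k) (r k)))"
  using assms by cases (auto simp: E_def)

lemma L2_mem: "L2 X \<in> calB2 X J \<rho>"
  using computable_component[of fst "(2, 0)"]
  by (rule mem_calB2I)
    (auto simp: L2_def L1_mem_mosch_ext star_name_odd star_name_component split: if_splits)

lemma R2_mem: "R2 X \<in> calB2 X J \<rho>"
  using computable_component[of snd "(2, Suc 0)"]
  by (rule mem_calB2I)
    (auto simp: R2_def R1_mem_mosch_ext star_name_odd star_name_component split: if_splits)

lemma T2_mem: "T2 X \<in> calB2 X J \<rho>"
  by (rule mem_calB2I[OF computable_const[of "E 0 0"]])
    (auto simp: T2_def star_name_const_pair split: if_splits)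

lemma F2_mem: "F2 X \<in> calB2 X J \<rho>"
  by (rule mem_calB2I[OF computable_const[of 0]])
    (auto simp: F2_def star_name.obj split: if_splits)

lemma mult_mem:
  assumes "\<phi> \<in> calB2 X J \<rho>" "\<psi> \<in> calB2 X J \<rho>"
  shows "mult \<phi> \<psi> \<in> calB2 X J \<rho>"
proof -
  obtain \<gamma> where \<gamma>: "computable_baire \<gamma>" "\<phi> \<in> calF2 X"
    "realizes \<gamma> \<phi>" using calB2E[OF assms(1)] .
  obtain \<delta> where \<delta>: "computable_baire \<delta>" "\<psi> \<in> calF2 X"
    "realizes \<delta> \<psi>" using calB2E[OF assms(2)] .
  have mult: "\<exists>Z. \<psi> z = Some Z \<and> Z \<subseteq> dom \<phi> \<and> Y = (\<Union>y\<in>Z. the (\<phi> y))"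
    if "mult \<phi> \<psi> z = Some Y" for z Y
    using that by (auto simp: mult_def split: option.splits if_splits)
  show ?thesis
  proof (rule mem_calB2I[OF computable_comp[OF \<gamma>(1) \<delta>(1)]])
    show "dom (mult \<phi> \<psi>) \<subseteq> mosch_ext X"
      using mult calF2D(1)[OF \<delta>(2)] by blast
    show "Y \<subseteq> mosch_ext X" if Y: "mult \<phi> \<psi> z = Some Y" for z Y
    proof -
      obtain Z where Z: "Z \<subseteq> dom \<phi>" "Y = (\<Union>y\<in>Z. the (\<phi> y))" using mult[OF Y] by blast
      have "the (\<phi> y) \<subseteq> mosch_ext X" if "y \<in> Z" for y
      proof -
        from Z(1) \<open>y \<in> Z\<close> obtain W where "\<phi> y = Some W" by blast
        then show ?thesis using calF2D(2)[OF \<gamma>(2)] by simp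
      qed
      then show ?thesis using Z(2) by blast
    qed
    fix p z Y assume p: "star_name J \<rho> p z" and "mult \<phi> \<psi> z = Some Y"
    then obtain Z where Z: "\<psi> z = Some Z" "Z \<subseteq> dom \<phi>" "Y = (\<Union>y\<in>Z. the (\<phi> y))"
      using mult by blast
    obtain q y where q: "\<delta> p = Some q" "star_name J \<rho> q y" "y \<in> Z"
      using realizesD[OF \<delta>(3) p Z(1)] by blast
    then obtain Y' where Y': "\<phi> y = Some Y'" using Z(2) by blast
    obtain r x where r: "\<gamma> q = Some r" "star_name J \<rho> r x" "x \<in> Y'"
      using realizesD[OF \<gamma>(3) q(2) Y'] by blast
    have "x \<in> Y" using Z(3) q(3) Y' r(3) by force
    then show "\<exists>q y. Option.bind (\<delta> p) \<gamma> = Some q \<and> star_name J \<rho> q y \<and> y \<in> Y"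
      using q(1) r by auto
  qed
qed

text \<open>
  A name of a pair is made from names of the components in every entry separately.
\<close>

lemma Pi2_mem:
  assumes "\<phi> \<in> calB2 X J \<rho>" "\<psi> \<in> calB2 X J \<rho>"
  shows "Pi2 \<phi> \<psi> \<in> calB2 X J \<rho>"
proof -
  obtain \<gamma> where \<gamma>: "computable_baire \<gamma>" "\<phi> \<in> calF2 X"
    "realizes \<gamma> \<phi>" using calB2E[OF assms(1)] .
  obtain \<delta> where \<delta>: "computable_baire \<delta>" "\<psi> \<in> calF2 X"
    "realizes \<delta> \<psi>" using calB2E[OF assms(2)] .
  have Pi2: "\<exists>Z W. \<phi> z = Some Z \<and> \<psi> z = Some W \<and> Y = {Pair x y |x y. x \<in> Z \<and> y \<in> W}"
    if "Pi2 \<phi> \<psi> z = Some Y" for z Y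
    using that by (auto simp: Pi2_def split: option.splits)
  show ?thesis
  proof (rule mem_calB2I[OF computable_pair[OF \<gamma>(1) \<delta>(1)]])
    show "dom (Pi2 \<phi> \<psi>) \<subseteq> mosch_ext X"
      using Pi2 calF2D(1)[OF \<delta>(2)] by blast
    show "Y \<subseteq> mosch_ext X" if "Pi2 \<phi> \<psi> z = Some Y" for z Y
      using Pi2[OF that] calF2D(2)[OF \<gamma>(2), of z] calF2D(2)[OF \<delta>(2), of z] by auto
    fix p z Y assume p: "star_name J \<rho> p z" and "Pi2 \<phi> \<psi> z = Some Y"
    then obtain Z W where ZW: "\<phi> z = Some Z" "\<psi> z = Some W"
      "Y = {Pair x y |x y. x \<in> Z \<and> y \<in> W}" using Pi2 by blast
    obtain q x where q: "\<gamma> p = Some q" "star_name J \<rho> q x" "x \<in> Z"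
      using realizesD[OF \<gamma>(3) p ZW(1)] by blast
    obtain r y where r: "\<delta> p = Some r" "star_name J \<rho> r y" "y \<in> W"
      using realizesD[OF \<delta>(3) p ZW(2)] by blast
    show "\<exists>u w. (case (\<gamma> p, \<delta> p) of
        (Some q, Some r) \<Rightarrow> Some (\<lambda>k. E (q k) (r k)) | _ \<Rightarrow> None) = Some u
        \<and> star_name J \<rho> u w \<and> w \<in> Y"
      using q r ZW(3) star_name_pair[OF q(2) r(2)] by auto
  qed
qed

text \<open>
  The realizer iterates \<open>\<gamma>\<close> under the control of \<open>\<delta>\<close>. Every result it has is correct, by induction
  along the derivation of \<open>iterates\<close>. It has a result because otherwise the names visited would
  never pass the test for stopping, and the objects that they name would form an infinite path.
\<close>

lemma iteration_mem:
  assumes "\<sigma> \<in> calB2 X J \<rho>" "\<chi> \<in> calB2 X J \<rho>"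
  shows "iteration X \<sigma> \<chi> \<in> calB2 X J \<rho>"
proof -
  obtain \<gamma> where \<gamma>: "computable_baire \<gamma>" "\<sigma> \<in> calF2 X"
    "realizes \<gamma> \<sigma>" using calB2E[OF assms(1)] .
  obtain \<delta> where \<delta>: "computable_baire \<delta>" "\<chi> \<in> calF2 X"
    "realizes \<delta> \<chi>" using calB2E[OF assms(2)] .
  let ?D = "iteration_dom X \<sigma> \<chi>"
  \<comment> \<open>The two conclusions do not exclude each other: \<open>\<chi> z\<close> may contain pairs and basic objects. The
      parity of the first entry merely shows which of them \<open>\<delta>\<close> has found.\<close>
  have test: "\<exists>c. \<delta> p = Some c \<and> (odd (c 0) \<longrightarrow> the (\<chi> z) - basic X \<noteq> {})
      \<and> (even (c 0) \<longrightarrow> the (\<chi> z) \<inter> basic X \<noteq> {})"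
    if z: "z \<in> ?D" and p: "star_name J \<rho> p z" for z p
  proof -
    obtain Y where Y: "\<chi> z = Some Y" using iteration_domD(1)[OF z] by blast
    obtain c y where c: "\<delta> p = Some c" "star_name J \<rho> c y" "y \<in> Y"
      using realizesD[OF \<delta>(3) p Y] by blast
    have "y \<in> mosch_ext X" using calF2D(2)[OF \<delta>(2) Y] c(3) by blast
    from mem_basic_iff[OF this] star_name_pair_iff_odd[OF c(2)] show ?thesis
      using Y c by auto
  qed
  have move: "\<exists>q z'. \<gamma> p = Some q \<and> star_name J \<rho> q z' \<and> path_step X \<sigma> \<chi> z z' \<and> z' \<in> ?D"
    if z: "z \<in> ?D" and p: "star_name J \<rho> p z" and odd: "\<delta> p = Some c" "odd (c 0)" for z p c
  proof -
    have ne: "the (\<chi> z) - basic X \<noteq> {}" using test[OF z p] odd by auto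
    obtain Y where Y: "\<sigma> z = Some Y" using iteration_domD(2)[OF z ne] by blast
    obtain q z' where q: "\<gamma> p = Some q" "star_name J \<rho> q z'" "z' \<in> Y"
      using realizesD[OF \<gamma>(3) p Y] by blast
    have st: "path_step X \<sigma> \<chi> z z'"
      using iteration_domD(1)[OF z] Y ne q(3) by (auto simp: path_step_def)
    have "z' \<in> mosch_ext X" using q(2) ex_name by blast
    from iteration_dom_step[OF z st this] q st show ?thesis by blast
  qed
  have result: "\<exists>v Y. star_name J \<rho> r v \<and> iteration X \<sigma> \<chi> z = Some Y \<and> v \<in> Y"
    if "iterates \<gamma> \<delta> p r" "z \<in> ?D" "star_name J \<rho> p z" for p r z
    using that
  proof (induction arbitrary: z)
    case (stop p c)
    have "finite_path X \<sigma> \<chi> [z]"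
      using stop.prems by (simp add: finite_path_def iteration_dom_def)
    moreover have "the (\<chi> z) \<inter> basic X \<noteq> {}" "z \<in> dom \<chi>"
      using test[OF stop.prems] stop.hyps iteration_domD(1)[OF stop.prems(1)] by auto
    ultimately show ?case
      using stop.prems unfolding iteration_def
      by (intro exI[of _ z]) (auto intro!: exI[of _ "[z]"])
  next
    case (go p c q r)
    obtain z' where z': "star_name J \<rho> q z'" "path_step X \<sigma> \<chi> z z'" "z' \<in> ?D"
      using move[OF go.prems go.hyps(1,2)] go.hyps(3) by auto
    from go.IH[OF z'(3,1)] iteration_step[OF go.prems(1) z'(2)] show ?case by blast
  qed
  have ends: "\<exists>r. iterates \<gamma> \<delta> p r" if z: "z \<in> ?D" and p: "star_name J \<rho> p z" for p z
  proof (rule ccontr)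
    define stuck where "stuck x \<longleftrightarrow> snd x \<in> ?D \<and> star_name J \<rho> (fst x) (snd x)
      \<and> \<not> (\<exists>r. iterates \<gamma> \<delta> (fst x) r)"
      for x :: "baire \<times> 'a mosch"
    assume "\<not> (\<exists>r. iterates \<gamma> \<delta> p r)"
    then have start: "stuck (p, z)" using z p by (simp add: stuck_def)
    have continue: "\<exists>y. stuck y \<and> path_step X \<sigma> \<chi> (snd x) (snd y)" if "stuck x" for x
    proof -
      have x: "snd x \<in> ?D" "star_name J \<rho> (fst x) (snd x)" "\<not> iterates \<gamma> \<delta> (fst x) r" for r
        using that by (auto simp: stuck_def)
      obtain c where c: "\<delta> (fst x) = Some c" using test[OF x(1,2)] by blast
      then have "odd (c 0)" using x(3) iterates.stop by blast
      then obtain q z' where "\<gamma> (fst x) = Some q" "star_name J \<rho> q z'"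
        "path_step X \<sigma> \<chi> (snd x) z'" "z' \<in> ?D"
        using move[OF x(1,2) c] by blast
      moreover from this have "\<not> (\<exists>r. iterates \<gamma> \<delta> q r)"
        using x(3) iterates.go[of \<delta> "fst x" c \<gamma> q] c \<open>odd (c 0)\<close> by blast
      ultimately show ?thesis by (intro exI[of _ "(q, z')"]) (simp add: stuck_def)
    qed
    have "\<exists>f. \<forall>n. (stuck (f n) \<and> (n = 0 \<longrightarrow> f n = (p, z)))
        \<and> path_step X \<sigma> \<chi> (snd (f n)) (snd (f (Suc n)))"
      by (rule dependent_nat_choice) (use start continue in auto)
    then obtain f where f: "\<And>n. stuck (f n)" "f 0 = (p, z)"
      "\<And>n. path_step X \<sigma> \<chi> (snd (f n)) (snd (f (Suc n)))" by blast
    have "infinite_path X \<sigma> \<chi> (\<lambda>n. snd (f n))"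
      using f(1,3) by (auto simp: infinite_path_def iteration_dom_def stuck_def)
    moreover have "snd (f 0) = z" by (simp add: f(2))
    ultimately show False using z unfolding iteration_dom_def by blast
  qed
  have dom: "z \<in> ?D" if "iteration X \<sigma> \<chi> z = Some Y" for z Y
    using that by (auto simp: iteration_def split: if_splits)
  show ?thesis
  proof (rule mem_calB2I[OF computable_iterate[OF \<gamma>(1) \<delta>(1)]])
    show "dom (iteration X \<sigma> \<chi>) \<subseteq> mosch_ext X"
      using dom by (auto simp: iteration_dom_def)
    show "Y \<subseteq> mosch_ext X" if "iteration X \<sigma> \<chi> z = Some Y" for z Y
      using that by (auto simp: iteration_def finite_path_def split: if_splits
          intro: subsetD[OF _ last_in_set])
    fix p z Y assume p: "star_name J \<rho> p z" and Y: "iteration X \<sigma> \<chi> z = Some Y"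
    obtain r where r: "iterate \<gamma> \<delta> p = Some r"
      using ends[OF dom[OF Y] p] by (auto simp: iterate_def)
    from result[OF iterate_SomeD[OF r] dom[OF Y] p] Y r
    show "\<exists>q y. iterate \<gamma> \<delta> p = Some q \<and> star_name J \<rho> q y \<and> y \<in> Y" by auto
  qed
qed

end

theorem theorem3p16:
  fixes X :: "'a set" and \<rho> :: "baire \<rightharpoonup> 'a" and J :: "nat \<times> nat \<Rightarrow> nat"
  assumes "representation \<rho> X"
    and "bij J" and "computable_nat2 J" and "\<And>m n. J (m, n) \<ge> max m n"
  shows "\<forall>\<theta> \<in> calF2 X. S2_computable X (calB2 X J \<rho>) \<theta> \<longrightarrow> \<theta> \<in> calB2 X J \<rho>"
proof (intro ballI impI)
  obtain PJ where "\<And>p m n. machine_outputs PJ p [m, n] (J (m, n))"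
    using assms(3) unfolding computable_nat2_def by blast
  then interpret represented_extension J PJ X \<rho>
    using assms(1,2,4) by unfold_locales (auto simp: bij_def)
  fix \<theta> assume "S2_computable X (calB2 X J \<rho>) \<theta>"
  then show "\<theta> \<in> calB2 X J \<rho>"
    by induction (simp_all add: L2_mem R2_mem T2_mem F2_mem mult_mem Pi2_mem iteration_mem)
qed

end
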